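(* Suppose that $c^{-1}\eta_0(\mu)\,d\mu$ is a probability measure such that $s\mapsto\int_{-1}^sc^{-1}\eta_0(\mu)\,d\mu$ has at least $n$ points of increase on $[-1,1]$. Then $$u_k=U\,T_k(\mathbf{H})\,\mathbf{e}_1\qquad\text{for }k=0,\ldots,n-1,$$ and $$f_k=\mathbf{e}_1^T(U^*U)\,T_k(\mathbf{H})\,\mathbf{e}_1\qquad\text{for }k=0,\ldots,2n-1,$$ where $$\mathbf{H}=(U^*U)^{-1}(U^*PU)\in\mathbb{R}^{n\times n}.$$
   Context: Let $x_{\max}>0$ and let $v$ be a sufficiently regular positive function on $[0,x_{\max}]$. Let $A=-v^2\frac{d^2}{dx^2}$ with boundary conditions $u_x|_{x=0}=0$, $u|_{x=x_{\max}}=0$; it is self-adjoint and positive definite for $\langle\langle u,w\rangle\rangle=\int_0^{x_{\max}}u(x)w(x)\frac{1}{v^2(x)}\,dx$. Let $\delta(x+0)$ be the right-half Dirac delta ($\int_0^\infty\delta(x+0)\,dx=1$, so $\langle\langle\delta(x+0),h\rangle\rangle=h(0)/v(0)^2$). Let $q\in L_1(\mathbb{R})$ be an even, sufficiently smooth approximation of $\delta(t)$ with nonnegative Fourier transform $\widetilde q(s^2)=\int_0^\infty2\cos(ts)q(t)\,dt$ and with $\widetilde q(A)$ positive definite (e.g. $\widetilde q(s^2)=e^{-\sigma^2s^2/2}$, $\sigma>0$). Put $b=v(0)\,\widetilde q(A)^{1/2}\delta(x+0)$. Fix $\tau>0$ and $n\in\mathbb{N}$. The propagator is $P=\cos(\tau\sqrt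 A)$, and for $k=0,\ldots,2n-1$ the snapshots are $u_k=\cos(k\tau\sqrt A)b=T_k(P)b$, where $T_k$ is the $k$th Chebyshev polynomial of the first kind. The data are $f_k=\langle\langle u_0,u_k\rangle\rangle$, $k=0,\ldots,2n-1$, and $c=f_0$. $U=[u_0,u_1,\ldots,u_{n-1}]$ is the row ("matrix") of the first $n$ snapshots; $U\mathbf{a}=\sum_{i=1}^na_iu_{i-1}$ for $\mathbf{a}\in\mathbb{R}^n$. $U^*U$ and $U^*PU$ are the $n\times n$ matrices with entries $\langle\langle u_{i-1},u_{j-1}\rangle\rangle$ and $\langle\langle u_{i-1},Pu_{j-1}\rangle\rangle$. $\mathbf{e}_1$ is the first standard basis vector of $\mathbb{R}^n$. Let $(\lambda_l,z_l)_{l\ge1}$ be the eigenpairs of $A$ with $\langle\langle z_l,z_k\rangle\rangle=\delta_{lk}$, and $\rho(x,\lambda)=\sum_{l\ge1}\delta(\lambda-\lambda_l)\frac{z_l(0)}{v(0)^2}z_l(x)$. Then $$\eta_0(\mu)=2\sum_{j=-\infty}^\infty\mathrm{sgn}(j)\,\widetilde q\!\left(\tfrac{(\arccos\mu+2j\pi)^2}{\tau^2}\right)\frac{\arccos\mu+2j\pi}{\tau^2}\,\rho\!\left(0,\tfrac{(\arccos\mu+2j\pi)^2}{\tau^2}\right)\frac1{\sqrt{1-\mu^2}},\qquad \mathrm{sgn}(0)=1,$$ i.e. $\eta_0(\mu)\,d\mu$ is the push-forward of $\sum_l\widetilde q(\lambda_l)\frac{z_l(0)^2}{v(0)^2}\delta_{\lambda_l}$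 under $\lambda\mapsto\cos(\tau\sqrt\lambda)$; it satisfies $f_k=\int_{-1}^1T_k(\mu)\eta_0(\mu)\,d\mu$. *)

theory Defs
  imports
    "HOL-Probability.Probability_Measure"
    "HOL-Computational_Algebra.Polynomial"
    "Jordan_Normal_Form.Gauss_Jordan_Elimination"
begin

no_notation Finite_Cartesian_Product.vec_nth (infixl \<open>$\<close> 90)
no_notation Inner_Product.real_inner_class.inner (infix \<open>\<bullet>\<close> 70)

text \<open>Throughout, \<open>X\<close> is the right endpoint of the interval and \<open>v\<close> the coefficient. Elements of
  the weighted \<open>L\<^sup>2\<close> space are represented by functions on the reals of which only the values on
  \<open>[0, X]\<close> matter; equality in that space is equality almost everywhere on \<open>[0, X]\<close>.\<close>

definition wip :: "real \<Rightarrow> (real \<Rightarrow> real) \<Rightarrow> (real \<Rightarrow> real) \<Rightarrow> (real \<Rightarrow> real) \<Rightarrow> real" where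
  "wip X v u w = (LINT x:{0..X}|lborel. u x * w x * (1 / (v x)\<^sup>2))"

definition wL2 :: "real \<Rightarrow> (real \<Rightarrow> real) \<Rightarrow> (real \<Rightarrow> real) set" where
  "wL2 X v = {u. set_borel_measurable lborel {0..X} u \<and>
                 set_integrable lborel {0..X} (\<lambda>x. (u x)\<^sup>2 * (1 / (v x)\<^sup>2))}"

text \<open>The graph of \<open>A = -v\<^sup>2 d\<^sup>2/dx\<^sup>2\<close> with the boundary conditions, on twice differentiable functions.
  For continuous positive \<open>v\<close> this is enough to describe the eigenpairs of the self-adjoint
  realisation: an eigenfunction satisfies \<open>u'' = -\<lambda> u / v\<^sup>2\<close>, hence has a continuous second
  derivative.\<close>

definition A_graph :: "real \<Rightarrow> (real \<Rightarrow> real) \<Rightarrow> (real \<Rightarrow> real) \<Rightarrow> (real \<Rightarrow> real) \<Rightarrow> bool" where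
  "A_graph X v u g \<longleftrightarrow> (\<exists>u' u''.
     (\<forall>x\<in>{0..X}. (u has_real_derivative u' x) (at x within {0..X}) \<and>
                 (u' has_real_derivative u'' x) (at x within {0..X}) \<and>
                 g x = - (v x)\<^sup>2 * u'' x) \<and>
     u' 0 = 0 \<and> u X = 0)"

definition eigenpair :: "real \<Rightarrow> (real \<Rightarrow> real) \<Rightarrow> real \<Rightarrow> (real \<Rightarrow> real) \<Rightarrow> bool" where
  "eigenpair X v \<mu> u \<longleftrightarrow> A_graph X v u (\<lambda>x. \<mu> * u x) \<and> (\<exists>x\<in>{0..X}. u x \<noteq> 0)"

text \<open>\<open>(lam l, z l)\<close> for \<open>l = 0, 1, \<dots>\<close> is an orthonormal enumeration of all eigenpairs (the
  eigenvalues of this Sturm-Liouville problem are simple).\<close>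

definition eigensystem ::
  "real \<Rightarrow> (real \<Rightarrow> real) \<Rightarrow> (nat \<Rightarrow> real) \<Rightarrow> (nat \<Rightarrow> real \<Rightarrow> real) \<Rightarrow> bool" where
  "eigensystem X v lam z \<longleftrightarrow>
     (\<forall>l. eigenpair X v (lam l) (z l)) \<and>
     (\<forall>l k. wip X v (z l) (z k) = (if l = k then 1 else 0)) \<and>
     (\<forall>\<mu> w. eigenpair X v \<mu> w \<longrightarrow>
        (\<exists>l a. \<mu> = lam l \<and> (\<forall>x\<in>{0..X}. w x = a * z l x)))"

text \<open>Functional calculus \<open>g(A)\<phi> = \<Sum>\<^sub>l g(\<lambda>\<^sub>l) \<phi>(z\<^sub>l) z\<^sub>l\<close>, the series converging in the weighted
  \<open>L\<^sup>2\<close> norm. The argument \<open>\<phi>\<close> is given by its pairing with functions, so that it may be an \<open>L\<^sup>2\<close>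
  function \<open>w\<close> (as \<open>wip X v w\<close>) or the right-half Dirac delta. The result is a representative,
  determined up to equality almost everywhere on \<open>[0, X]\<close>; it is unspecified if the series
  diverges.\<close>

definition fun_calc ::
  "real \<Rightarrow> (real \<Rightarrow> real) \<Rightarrow> (nat \<Rightarrow> real) \<Rightarrow> (nat \<Rightarrow> real \<Rightarrow> real) \<Rightarrow>
   (real \<Rightarrow> real) \<Rightarrow> ((real \<Rightarrow> real) \<Rightarrow> real) \<Rightarrow> real \<Rightarrow> real" where
  "fun_calc X v lam z g \<phi> = (SOME w. w \<in> wL2 X v \<and>
     (\<lambda>N. let r = (\<lambda>x. w x - (\<Sum>l<N. g (lam l) * \<phi> (z l) * z l x)) in wip X v r r)
       \<longlonglongrightarrow> 0)"

definition fun_op ::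
  "real \<Rightarrow> (real \<Rightarrow> real) \<Rightarrow> (nat \<Rightarrow> real) \<Rightarrow> (nat \<Rightarrow> real \<Rightarrow> real) \<Rightarrow>
   (real \<Rightarrow> real) \<Rightarrow> (real \<Rightarrow> real) \<Rightarrow> real \<Rightarrow> real" where
  "fun_op X v lam z g w = fun_calc X v lam z g (wip X v w)"

definition pos_def_op ::
  "real \<Rightarrow> (real \<Rightarrow> real) \<Rightarrow> ((real \<Rightarrow> real) \<Rightarrow> real \<Rightarrow> real) \<Rightarrow> bool" where
  "pos_def_op X v Q \<longleftrightarrow> (\<forall>w\<in>wL2 X v. wip X v w w \<noteq> 0 \<longrightarrow> wip X v w (Q w) > 0)"

definition delta0 :: "(real \<Rightarrow> real) \<Rightarrow> (real \<Rightarrow> real) \<Rightarrow> real" where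
  "delta0 v h = h 0 / (v 0)\<^sup>2"

text \<open>As a function of \<open>r = s\<^sup>2\<close>.\<close>

definition qt :: "(real \<Rightarrow> real) \<Rightarrow> real \<Rightarrow> real" where
  "qt q r = (LINT t:{0..}|lborel. 2 * cos (t * sqrt r) * q t)"

definition source ::
  "real \<Rightarrow> (real \<Rightarrow> real) \<Rightarrow> (nat \<Rightarrow> real) \<Rightarrow> (nat \<Rightarrow> real \<Rightarrow> real) \<Rightarrow>
   (real \<Rightarrow> real) \<Rightarrow> real \<Rightarrow> real" where
  "source X v lam z q =
     (\<lambda>x. v 0 * fun_calc X v lam z (\<lambda>s. sqrt (qt q s)) (delta0 v) x)"

definition propagator ::
  "real \<Rightarrow> (real \<Rightarrow> real) \<Rightarrow> (nat \<Rightarrow> real) \<Rightarrow> (nat \<Rightarrow> real \<Rightarrow> real) \<Rightarrow>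
   real \<Rightarrow> (real \<Rightarrow> real) \<Rightarrow> real \<Rightarrow> real" where
  "propagator X v lam z \<tau> = fun_op X v lam z (\<lambda>s. cos (\<tau> * sqrt s))"

definition snapshot ::
  "real \<Rightarrow> (real \<Rightarrow> real) \<Rightarrow> (nat \<Rightarrow> real) \<Rightarrow> (nat \<Rightarrow> real \<Rightarrow> real) \<Rightarrow>
   (real \<Rightarrow> real) \<Rightarrow> real \<Rightarrow> nat \<Rightarrow> real \<Rightarrow> real" where
  "snapshot X v lam z q \<tau> k =
     fun_op X v lam z (\<lambda>s. cos (real k * \<tau> * sqrt s)) (source X v lam z q)"

text \<open>The measure \<open>\<Sum>\<^sub>l q(\<lambda>\<^sub>l) z\<^sub>l(0)\<^sup>2 / v(0)\<^sup>2 \<delta>\<^bsub>\<lambda>\<^sub>l\<^esub>\<close> (with \<open>q\<close> the transformed one) and its push-forward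
  \<open>\<eta>\<^sub>0(\<mu>) d\<mu>\<close>. The latter is purely atomic: the density \<open>\<eta>\<^sub>0\<close> is a distribution.\<close>

definition spectral_measure ::
  "(real \<Rightarrow> real) \<Rightarrow> (nat \<Rightarrow> real) \<Rightarrow> (nat \<Rightarrow> real \<Rightarrow> real) \<Rightarrow> (real \<Rightarrow> real) \<Rightarrow> real measure" where
  "spectral_measure v lam z q =
     distr (density (count_space UNIV) (\<lambda>l. ennreal (qt q (lam l) * ((z l 0)\<^sup>2 / (v 0)\<^sup>2)))) borel lam"

definition eta0 ::
  "(real \<Rightarrow> real) \<Rightarrow> (nat \<Rightarrow> real) \<Rightarrow> (nat \<Rightarrow> real \<Rightarrow> real) \<Rightarrow> (real \<Rightarrow> real) \<Rightarrow> real \<Rightarrow>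
   real measure" where
  "eta0 v lam z q \<tau> = distr (spectral_measure v lam z q) borel (\<lambda>s. cos (\<tau> * sqrt s))"

definition point_of_increase :: "(real \<Rightarrow> real) \<Rightarrow> real \<Rightarrow> bool" where
  "point_of_increase F s \<longleftrightarrow> (\<forall>\<epsilon>>0. F (s - \<epsilon>) < F (s + \<epsilon>))"

text \<open>The integral over \<open>[-1, s]\<close> includes an atom at \<open>-1\<close> and vanishes for \<open>s < -1\<close>, so that an
  atom at \<open>-1\<close> makes \<open>-1\<close> a point of increase.\<close>

definition at_least_points_of_increase :: "nat \<Rightarrow> real measure \<Rightarrow> bool" where
  "at_least_points_of_increase n M \<longleftrightarrow>
     (\<exists>S\<subseteq>{-1..1}. finite S \<and> card S = n \<and>
        (\<forall>s\<in>S. point_of_increase (\<lambda>s. measure M {-1..s}) s))"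

fun cheb :: "nat \<Rightarrow> real poly" where
  "cheb 0 = 1"
| "cheb (Suc 0) = [:0, 1:]"
| "cheb (Suc (Suc k)) = [:0, 2:] * cheb (Suc k) - cheb k"

definition poly_mat :: "real poly \<Rightarrow> real mat \<Rightarrow> real mat" where
  "poly_mat p M = mat (dim_row M) (dim_row M)
     (\<lambda>(i, j). \<Sum>k\<le>degree p. coeff p k * (M ^\<^sub>m k) $$ (i, j))"

text \<open>For a row \<open>U = [u 0, \<dots>, u (n-1)]\<close>: the function \<open>U a\<close>, and the matrix \<open>U\<^sup>* L U\<close> for an
  operator \<open>L\<close>.\<close>

definition row_comb :: "(nat \<Rightarrow> real \<Rightarrow> real) \<Rightarrow> real vec \<Rightarrow> real \<Rightarrow> real" where
  "row_comb u a = (\<lambda>x. \<Sum>i<dim_vec a. a $ i * u i x)"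

definition gram ::
  "real \<Rightarrow> (real \<Rightarrow> real) \<Rightarrow> nat \<Rightarrow> (nat \<Rightarrow> real \<Rightarrow> real) \<Rightarrow>
   ((real \<Rightarrow> real) \<Rightarrow> real \<Rightarrow> real) \<Rightarrow> real mat" where
  "gram X v n u L = mat n n (\<lambda>(i, j). wip X v (u i) (L (u j)))"

end

theory Submission
  imports Defs "Jordan_Normal_Form.Determinant"
begin

text \<open>
  In the orthonormal eigenbasis of \<open>A\<close>, the source has the coefficients
  \<open>\<alpha>\<^sub>l = q(\<lambda>\<^sub>l)\<^sup>1\<^sup>/\<^sup>2 z\<^sub>l(0) / v(0)\<close> (with \<open>q\<close> the transformed one), and \<open>P\<close> multiplies the coefficients by
  \<open>\<mu>\<^sub>l = cos (\<tau> \<surd>\<lambda>\<^sub>l)\<close>. Hence \<open>u\<^sub>k\<close> has the coefficients \<open>T\<^sub>k(\<mu>\<^sub>l) \<alpha>\<^sub>l\<close>, and with the functional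
  \<open>L(p) = \<Sum>\<^sub>l \<alpha>\<^sub>l\<^sup>2 p(\<mu>\<^sub>l)\<close>, which is integration against \<open>\<eta>\<^sub>0\<close>, the entries of \<open>U\<^sup>*U\<close> and \<open>U\<^sup>*PU\<close> are
  \<open>L(T\<^sub>i T\<^sub>j)\<close> and \<open>L(T\<^sub>i x T\<^sub>j)\<close>. For this reduction the series must converge in the weighted \<open>L\<^sup>2\<close> space: the
  coefficients of the source are square summable because \<open>\<eta>\<^sub>0\<close> has finite mass, and the theorem
  \<open>Riesz_Fischer\<close> does the rest.

  The remaining argument is about \<open>L\<close> only. The \<open>n\<close> points of increase lie in the closure of the
  atoms of the measure, so a polynomial of degree less than \<open>n\<close> with \<open>L(p\<^sup>2) = 0\<close> is zero
  (\<open>weighted_square_sum_definite\<close>); this makes \<open>G = U\<^sup>*U\<close> invertible. The identity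
  \<open>2 x T\<^sub>k = T\<^sub>k\<^sub>+\<^sub>1 + T\<^sub>k\<^sub>-\<^sub>1\<close> says that \<open>H\<close>, as long as the index stays below \<open>n\<close>, shifts the unit vectors as
  multiplication by \<open>x\<close> shifts the Chebyshev polynomials, so that \<open>T\<^sub>k(H) e\<^sub>1\<close> is the
  unit vector \<open>e\<^sub>k\<^sub>+\<^sub>1\<close> (\<open>cheb_vec_unit\<close>). This is the first formula. For \<open>k \<ge> n\<close> the vector \<open>T\<^sub>k(H) e\<^sub>1\<close> is
  no unit vector any more, but the leading entries of \<open>G T\<^sub>k(H) e\<^sub>1\<close> are still the moments
  \<open>L(T\<^sub>i T\<^sub>k)\<close>, one entry fewer for each further step; the first survives until \<open>k = 2 n - 1\<close>
  (\<open>G_cheb_vec\<close>). This is the second formula.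
\<close>

section \<open>Polynomials of a matrix\<close>

lemma poly_mat_carrier [simp]:
  assumes "M \<in> carrier_mat n n"
  shows "poly_mat p M \<in> carrier_mat n n"
  using assms by (auto simp: poly_mat_def)

text \<open>Allowing more terms than the degree puts two polynomials of different degree on the same index
  set; it is what makes \<open>poly_mat\<close> additive.\<close>
lemma poly_mat_entry:
  assumes M: "M \<in> carrier_mat n n" and "i < n" "j < n" and d: "degree p \<le> d"
  shows "poly_mat p M $$ (i, j) = (\<Sum>k\<le>d. coeff p k * (M ^\<^sub>m k) $$ (i, j))"
proof -
  have "poly_mat p M $$ (i, j) = (\<Sum>k\<le>degree p. coeff p k * (M ^\<^sub>m k) $$ (i, j))"
    using assms by (auto simp: poly_mat_def)
  also have "\<dots> = (\<Sum>k\<le>d. coeff p k * (M ^\<^sub>m k) $$ (i, j))"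
    using d by (intro sum.mono_neutral_left) (auto intro: coeff_eq_0)
  finally show ?thesis .
qed

lemma poly_mat_diff:
  assumes M: "M \<in> carrier_mat n n"
  shows "poly_mat (p - q) M = poly_mat p M - poly_mat q M"
proof (rule eq_matI)
  fix i j assume "i < dim_row (poly_mat p M - poly_mat q M)" "j < dim_col (poly_mat p M - poly_mat q M)"
  then have ij: "i < n" "j < n" using M by (auto simp: poly_mat_def)
  let ?d = "max (degree p) (degree q)"
  have "poly_mat (p - q) M $$ (i, j) = (\<Sum>k\<le>?d. coeff (p - q) k * (M ^\<^sub>m k) $$ (i, j))"
    by (rule poly_mat_entry[OF M ij degree_diff_le_max])
  also have "\<dots> = (\<Sum>k\<le>?d. coeff p k * (M ^\<^sub>m k) $$ (i, j))
      - (\<Sum>k\<le>?d. coeff q k * (M ^\<^sub>m k) $$ (i, j))"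
    by (simp add: sum_subtractf left_diff_distrib)
  also have "\<dots> = poly_mat p M $$ (i, j) - poly_mat q M $$ (i, j)"
    by (simp only: poly_mat_entry[OF M ij max.cobounded1[of "degree p" "degree q"]]
        poly_mat_entry[OF M ij max.cobounded2[of "degree q" "degree p"]])
  also have "\<dots> = (poly_mat p M - poly_mat q M) $$ (i, j)"
    using ij M by (subst index_minus_mat(1)) (auto simp: poly_mat_def)
  finally show "poly_mat (p - q) M $$ (i, j) = (poly_mat p M - poly_mat q M) $$ (i, j)" .
qed (use M in \<open>auto simp: poly_mat_def\<close>)

lemma pow_mat_Suc_left:
  assumes "M \<in> carrier_mat n n"
  shows "M ^\<^sub>m Suc k = M * M ^\<^sub>m k"
proof (induction k)
  case (Suc k)
  have "M ^\<^sub>m Suc (Suc k) = (M * M ^\<^sub>m k) * M" using Suc by simp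
  also have "\<dots> = M * M ^\<^sub>m Suc k"
    using assms by (simp add: assoc_mult_mat[of _ n n _ n _ n] pow_carrier_mat)
  finally show ?case .
qed (use assms in auto)

lemma poly_mat_X_mult:
  assumes M: "M \<in> carrier_mat n n"
  shows "poly_mat ([:0, c:] * p) M = c \<cdot>\<^sub>m (M * poly_mat p M)"
proof (rule eq_matI)
  fix i j
  assume "i < dim_row (c \<cdot>\<^sub>m (M * poly_mat p M))" "j < dim_col (c \<cdot>\<^sub>m (M * poly_mat p M))"
  then have ij: "i < n" "j < n" using M by (auto simp: poly_mat_def)
  have dims: "dim_row (poly_mat p M) = n" "dim_col (poly_mat p M) = n"
    using M by (auto simp: poly_mat_def)
  let ?d = "degree p"
  have eq: "[:0, c:] * p = pCons 0 (Polynomial.smult c p)" by simp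
  have "degree ([:0, c:] * p) \<le> Suc ?d" by (simp add: degree_pCons_eq_if)
  then have "poly_mat ([:0, c:] * p) M $$ (i, j)
      = (\<Sum>k\<le>Suc ?d. coeff (pCons 0 (Polynomial.smult c p)) k * (M ^\<^sub>m k) $$ (i, j))"
    by (simp only: poly_mat_entry[OF M ij] eq)
  also have "\<dots> = (\<Sum>k\<le>?d. c * coeff p k * (M ^\<^sub>m Suc k) $$ (i, j))"
    by (subst sum.atMost_Suc_shift) simp
  also have "\<dots> = (\<Sum>k\<le>?d. c * coeff p k * (\<Sum>m<n. M $$ (i, m) * (M ^\<^sub>m k) $$ (m, j)))"
  proof (rule sum.cong[OF refl])
    fix k
    have "(M ^\<^sub>m Suc k) $$ (i, j) = (\<Sum>m<n. M $$ (i, m) * (M ^\<^sub>m k) $$ (m, j))"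
      using M ij unfolding pow_mat_Suc_left[OF M]
      by (simp add: scalar_prod_def lessThan_atLeast0 pow_carrier_mat)
    then show "c * coeff p k * (M ^\<^sub>m Suc k) $$ (i, j)
        = c * coeff p k * (\<Sum>m<n. M $$ (i, m) * (M ^\<^sub>m k) $$ (m, j))" by simp
  qed
  also have "\<dots> = c * (\<Sum>m<n. M $$ (i, m) * (\<Sum>k\<le>?d. coeff p k * (M ^\<^sub>m k) $$ (m, j)))"
    by (simp add: sum_distrib_left sum.swap[of _ "{..?d}"] mult_ac)
  also have "\<dots> = (c \<cdot>\<^sub>m (M * poly_mat p M)) $$ (i, j)"
    using M ij dims
    by (simp add: scalar_prod_def lessThan_atLeast0 poly_mat_entry[OF M _ ij(2) order_refl])
  finally show "poly_mat ([:0, c:] * p) M $$ (i, j) = (c \<cdot>\<^sub>m (M * poly_mat p M)) $$ (i, j)" .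
qed (use M in \<open>auto simp: poly_mat_def\<close>)

lemma poly_mat_1:
  assumes "M \<in> carrier_mat n n"
  shows "poly_mat 1 M = 1\<^sub>m n"
  using assms by (intro eq_matI) (auto simp: poly_mat_def)

lemma poly_mat_cheb_vec:
  assumes M: "M \<in> carrier_mat n n" and x: "x \<in> carrier_vec n"
  shows "poly_mat (cheb 0) M *\<^sub>v x = x"
    and "poly_mat (cheb (Suc 0)) M *\<^sub>v x = M *\<^sub>v x"
    and "poly_mat (cheb (Suc (Suc k))) M *\<^sub>v x
       = 2 \<cdot>\<^sub>v (M *\<^sub>v (poly_mat (cheb (Suc k)) M *\<^sub>v x)) - poly_mat (cheb k) M *\<^sub>v x"
proof -
  show "poly_mat (cheb 0) M *\<^sub>v x = x" using M x by (simp add: poly_mat_1)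
  have "poly_mat (cheb (Suc 0)) M = 1 \<cdot>\<^sub>m (M * 1\<^sub>m n)"
    using poly_mat_X_mult[OF M, of 1 1] by (simp add: poly_mat_1[OF M])
  also have "\<dots> = M" using M by auto
  finally show "poly_mat (cheb (Suc 0)) M *\<^sub>v x = M *\<^sub>v x" by simp
  have c: "poly_mat p M \<in> carrier_mat n n" for p using M by simp
  have s: "(a \<cdot>\<^sub>m A) *\<^sub>v x = a \<cdot>\<^sub>v (A *\<^sub>v x)" if "A \<in> carrier_mat n n" for a :: real and A
    using that x by (intro eq_vecI) (auto simp: scalar_prod_def sum_distrib_left mult_ac)
  show "poly_mat (cheb (Suc (Suc k))) M *\<^sub>v x
       = 2 \<cdot>\<^sub>v (M *\<^sub>v (poly_mat (cheb (Suc k)) M *\<^sub>v x)) - poly_mat (cheb k) M *\<^sub>v x"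
    using M x c
    by (simp only: cheb.simps poly_mat_diff[OF M] poly_mat_X_mult[OF M]
          minus_mult_distrib_mat_vec[of _ n n] s smult_carrier_mat mult_carrier_mat
          assoc_mult_mat_vec[of _ n n _ n])
qed

section \<open>Chebyshev polynomials\<close>

lemma degree_cheb: "degree (cheb k) = k"
proof (induction k rule: cheb.induct)
  case (3 k)
  then have "degree (cheb (Suc k)) = Suc k" "degree (cheb k) = k" by auto
  moreover from this have "degree ([:0, 2:] * cheb (Suc k)) = Suc (Suc k)"
    by (subst degree_mult_eq) auto
  ultimately show ?case
    using degree_add_eq_left[of "- cheb k" "[:0, 2:] * cheb (Suc k)"] by simp
qed auto

lemma cheb_ne_0: "cheb k \<noteq> 0"
  using degree_cheb[of k] by (cases k) auto

text \<open>The degrees are distinct, so the coefficient of \<open>x\<^sup>n\<^sup>-\<^sup>1\<close> isolates the last term.\<close>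
lemma cheb_independent:
  assumes "(\<Sum>i<n. Polynomial.smult (a i) (cheb i)) = 0" "i < n"
  shows "a i = 0"
  using assms
proof (induction n)
  case (Suc n)
  have "coeff (\<Sum>i<n. Polynomial.smult (a i) (cheb i)) n = 0"
    by (auto simp: coeff_sum intro!: sum.neutral coeff_eq_0 simp: degree_cheb)
  then have "coeff (\<Sum>i<Suc n. Polynomial.smult (a i) (cheb i)) n = a n * lead_coeff (cheb n)"
    by (simp add: degree_cheb)
  then have "a n * lead_coeff (cheb n) = 0" by (metis Suc.prems(1) coeff_0)
  then have "a n = 0" using cheb_ne_0[of n] by simp
  then show ?case using Suc by (cases "i = n") auto
qed auto

lemma degree_cheb_comb:
  assumes "n \<ge> 1"
  shows "degree (\<Sum>i<n. Polynomial.smult (a i) (cheb i)) < n"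
proof -
  have "degree (\<Sum>i<n. Polynomial.smult (a i) (cheb i)) \<le> n - 1"
    by (rule degree_sum_le)
      (auto intro!: order_trans[OF degree_smult_le] simp: degree_cheb)
  then show ?thesis using assms by simp
qed

lemma poly_cheb_cos: "poly (cheb k) (cos t) = cos (real k * t)"
proof (induction k rule: cheb.induct)
  case (3 k)
  have "cos (real (Suc (Suc k)) * t) = cos (real (Suc k) * t + t)"
    and "cos (real k * t) = cos (real (Suc k) * t - t)" by (simp_all add: algebra_simps)
  then show ?case using 3 by (simp add: cos_add cos_diff)
qed auto

section \<open>Gram matrices of a definite moment functional\<close>

text \<open>The model is the moment functional \<open>L(p) = \<integral> p d\<mu>\<close> of a positive measure whose support has at
  least \<open>n\<close> points. Everything about \<open>U\<^sup>*U\<close>, \<open>U\<^sup>*PU\<close> and \<open>H\<close> (below \<open>G\<close>, \<open>K\<close> and \<open>H\<close>) can be said in terms of \<open>L\<close> alone, because the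
  snapshots correspond to the polynomials \<open>T\<^sub>k\<close> and the propagator to multiplication by the variable.\<close>

locale definite_functional =
  fixes L :: "real poly \<Rightarrow> real" and n :: nat
  assumes L_add: "L (p + q) = L p + L q"
    and L_smult: "L (Polynomial.smult c p) = c * L p"
    and definite: "degree p < n \<Longrightarrow> L (p * p) = 0 \<Longrightarrow> p = 0"
    and n_pos: "n \<ge> 1"
begin

definition G :: "real mat" where "G = mat n n (\<lambda>(i, j). L (cheb i * cheb j))"
definition K :: "real mat" where "K = mat n n (\<lambda>(i, j). L (cheb i * ([:0, 1:] * cheb j)))"

lemma G_carrier [simp]: "G \<in> carrier_mat n n" by (simp add: G_def)
lemma K_carrier [simp]: "K \<in> carrier_mat n n" by (simp add: K_def)
lemma G_K_dim [simp]: "dim_row G = n" "dim_col G = n" "dim_row K = n" "dim_col K = n"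
  by (simp_all add: G_def K_def)

lemma L_0: "L 0 = 0" using L_smult[of 0 0] by simp

lemma L_diff: "L (p - q) = L p - L q"
  using L_add[of p "Polynomial.smult (-1) q"] L_smult[of "-1" q] by simp

lemma L_sum: "L (\<Sum>i\<in>I. p i) = (\<Sum>i\<in>I. L (p i))"
  by (induction I rule: infinite_finite_induct) (auto simp: L_0 L_add)

text \<open>If \<open>G a = 0\<close>, then \<open>p = \<Sum>\<^sub>i a\<^sub>i T\<^sub>i\<close> satisfies \<open>L(p\<^sup>2) = a\<^sup>T G a = 0\<close>, hence \<open>p = 0\<close> and \<open>a = 0\<close>.\<close>
lemma G_inverse:
  obtains B where "mat_inverse G = Some B" "B \<in> carrier_mat n n" "G * B = 1\<^sub>m n" "B * G = 1\<^sub>m n"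
proof -
  have "det G \<noteq> 0"
  proof
    assume "det G = 0"
    then obtain a where a: "a \<in> carrier_vec n" "a \<noteq> 0\<^sub>v n" "G *\<^sub>v a = 0\<^sub>v n"
      by (auto simp: det_0_iff_vec_prod_zero_field[of _ n])
    define p where "p = (\<Sum>i<n. Polynomial.smult (a $ i) (cheb i))"
    have Ga: "(\<Sum>j<n. a $ j * L (cheb i * cheb j)) = 0" if "i < n" for i
    proof -
      have "(G *\<^sub>v a) $ i = (\<Sum>j<n. a $ j * L (cheb i * cheb j))"
        using that a(1) by (auto simp: G_def scalar_prod_def lessThan_atLeast0 mult.commute)
      then show ?thesis using a(3) that by simp
    qed
    have "p * p = (\<Sum>i<n. \<Sum>j<n. Polynomial.smult (a $ j * a $ i) (cheb i * cheb j))"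
      by (simp add: p_def sum_product)
    then have "L (p * p) = (\<Sum>i<n. a $ i * (\<Sum>j<n. a $ j * L (cheb i * cheb j)))"
      by (simp add: L_sum L_smult sum_distrib_left mult_ac)
    also have "\<dots> = 0" by (simp add: Ga)
    finally have "p = 0"
      using definite degree_cheb_comb[OF n_pos, of "\<lambda>i. a $ i"] by (simp add: p_def)
    then have "a $ i = 0" if "i < n" for i
      using cheb_independent[of "\<lambda>i. a $ i" n] that by (simp add: p_def)
    then show False using a(1,2) by (auto simp: vec_eq_iff)
  qed
  then have "G \<in> Units (ring_mat TYPE(real) n ())"
    by (rule det_non_zero_imp_unit[OF G_carrier])
  then obtain B where "mat_inverse G = Some B"
    using mat_inverse(1)[OF G_carrier, where b = "()"] by (cases "mat_inverse G") auto
  with mat_inverse(2)[OF G_carrier this] that show ?thesis by blast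
qed

lemma invertible_G: "invertible_mat G"
proof -
  obtain B where "B \<in> carrier_mat n n" "G * B = 1\<^sub>m n" "B * G = 1\<^sub>m n" by (rule G_inverse)
  then show ?thesis
    unfolding invertible_mat_def inverts_mat_def by (auto simp: G_def)
qed

definition H :: "real mat" where "H = the (mat_inverse G) * K"

lemma H_carrier [simp]: "H \<in> carrier_mat n n"
  using G_inverse by (metis H_def K_carrier mult_carrier_mat option.sel)

lemma G_H: "G * H = K"
proof -
  obtain B where B: "mat_inverse G = Some B" "B \<in> carrier_mat n n" "G * B = 1\<^sub>m n"
    by (rule G_inverse)
  have "G * H = (G * B) * K"
    by (simp add: H_def B(1) assoc_mult_mat[OF G_carrier B(2) K_carrier])
  then show ?thesis using left_mult_one_mat[OF K_carrier] by (simp add: B(3))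
qed

lemma G_inj:
  assumes "x \<in> carrier_vec n" "y \<in> carrier_vec n" "G *\<^sub>v x = G *\<^sub>v y"
  shows "x = y"
proof -
  obtain B where B: "B \<in> carrier_mat n n" "B * G = 1\<^sub>m n" by (rule G_inverse)
  have "(B * G) *\<^sub>v x = (B * G) *\<^sub>v y"
    using assms B(1) by (simp add: assoc_mult_mat_vec[of _ n n _ n])
  then show ?thesis using assms B by simp
qed

definition cheb_vec :: "nat \<Rightarrow> real vec" where "cheb_vec k = poly_mat (cheb k) H *\<^sub>v unit_vec n 0"

lemma cheb_vec_carrier [simp]: "cheb_vec k \<in> carrier_vec n"
  by (auto simp: cheb_vec_def intro!: mult_mat_vec_carrier[of _ n n])

lemma cheb_vec_0: "cheb_vec 0 = unit_vec n 0"
  and cheb_vec_1: "cheb_vec (Suc 0) = H *\<^sub>v unit_vec n 0"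
  and cheb_vec_rec: "cheb_vec (Suc (Suc k)) = 2 \<cdot>\<^sub>v (H *\<^sub>v cheb_vec (Suc k)) - cheb_vec k"
  unfolding cheb_vec_def by (simp_all only: poly_mat_cheb_vec[OF H_carrier unit_vec_carrier])

lemma G_H_vec: "x \<in> carrier_vec n \<Longrightarrow> G *\<^sub>v (H *\<^sub>v x) = K *\<^sub>v x"
  by (simp add: G_H flip: assoc_mult_mat_vec[of _ n n _ n])

lemma G_cheb_vec_1: "G *\<^sub>v cheb_vec (Suc 0) = K *\<^sub>v unit_vec n 0"
  by (simp add: cheb_vec_1 G_H_vec)

lemma G_cheb_vec_rec:
  "G *\<^sub>v cheb_vec (Suc (Suc k)) = 2 \<cdot>\<^sub>v (K *\<^sub>v cheb_vec (Suc k)) - G *\<^sub>v cheb_vec k"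
proof -
  have "H *\<^sub>v cheb_vec (Suc k) \<in> carrier_vec n" by (auto intro!: mult_mat_vec_carrier[of _ n n])
  then show ?thesis
    by (simp add: cheb_vec_rec mult_minus_distrib_mat_vec[of _ n n] mult_mat_vec[of _ n n] G_H_vec)
qed

lemma G_unit: "i < n \<Longrightarrow> k < n \<Longrightarrow> (G *\<^sub>v unit_vec n k) $ i = L (cheb i * cheb k)"
  and K_unit: "i < n \<Longrightarrow> k < n \<Longrightarrow> (K *\<^sub>v unit_vec n k) $ i = L (cheb i * ([:0, 1:] * cheb k))"
  by (auto simp: G_def K_def)

lemma cheb_rec_L:
  "L (p * cheb (Suc (Suc k))) = 2 * L (p * ([:0, 1:] * cheb (Suc k))) - L (p * cheb k)"
proof -
  have "p * cheb (Suc (Suc k)) = Polynomial.smult 2 (p * ([:0, 1:] * cheb (Suc k))) - p * cheb k"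
    by (simp add: algebra_simps)
  then show ?thesis by (simp only: L_diff L_smult)
qed

text \<open>For \<open>k + 1 < n\<close>, column \<open>k\<close> of \<open>K\<close> is the mean of the columns \<open>k - 1\<close> and \<open>k + 1\<close> of \<open>G\<close> (column
  \<open>1\<close> if \<open>k = 0\<close>), so \<open>H\<close> maps \<open>e\<^sub>k\<close> to the mean of the neighbouring unit vectors. The vectors \<open>T\<^sub>k(H) e\<^sub>0\<close> and \<open>e\<^sub>k\<close> then obey the same recurrence;
  comparing them after applying the injective \<open>G\<close> keeps the inverse out of the calculation.\<close>
lemma cheb_vec_unit: "k < n \<Longrightarrow> cheb_vec k = unit_vec n k"
proof (induction k rule: cheb.induct)
  case 1
  then show ?case by (simp add: cheb_vec_0)
next
  case 2
  have "G *\<^sub>v cheb_vec (Suc 0) = G *\<^sub>v unit_vec n (Suc 0)"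
  proof (rule eq_vecI)
    fix i assume "i < dim_vec (G *\<^sub>v unit_vec n (Suc 0))"
    then have i: "i < n" by simp
    have "(G *\<^sub>v cheb_vec (Suc 0)) $ i = L (cheb i * ([:0, 1:] * cheb 0))"
      unfolding G_cheb_vec_1 using 2 i by (intro K_unit) auto
    also have "\<dots> = (G *\<^sub>v unit_vec n (Suc 0)) $ i"
      using G_unit[OF i 2] by (simp only: cheb.simps mult_1_right)
    finally show "(G *\<^sub>v cheb_vec (Suc 0)) $ i = (G *\<^sub>v unit_vec n (Suc 0)) $ i" .
  qed simp
  then show ?case by (rule G_inj[rotated 2]) auto
next
  case (3 k)
  have "G *\<^sub>v cheb_vec (Suc (Suc k)) = G *\<^sub>v unit_vec n (Suc (Suc k))"
  proof (rule eq_vecI)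
    fix i assume "i < dim_vec (G *\<^sub>v unit_vec n (Suc (Suc k)))"
    then have i: "i < n" by simp
    have "(G *\<^sub>v cheb_vec (Suc (Suc k))) $ i
        = 2 * (K *\<^sub>v unit_vec n (Suc k)) $ i - (G *\<^sub>v unit_vec n k) $ i"
      unfolding G_cheb_vec_rec using 3 i by (simp del: index_mult_mat_vec)
    also have "\<dots> = L (cheb i * cheb (Suc (Suc k)))"
      unfolding cheb_rec_L using 3(3) i by (simp only: K_unit G_unit Suc_lessD)
    also have "\<dots> = (G *\<^sub>v unit_vec n (Suc (Suc k))) $ i"
      by (rule G_unit[symmetric]) (use 3(3) i in auto)
    finally show "(G *\<^sub>v cheb_vec (Suc (Suc k))) $ i = (G *\<^sub>v unit_vec n (Suc (Suc k))) $ i" .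
  qed simp
  then show ?case by (rule G_inj[rotated 2]) auto
qed

text \<open>The same relation for the rows: row \<open>i\<close> of \<open>K\<close> is the mean of the rows \<open>i - 1\<close> and \<open>i + 1\<close> of \<open>G\<close> (row
  \<open>1\<close> if \<open>i = 0\<close>), that is, \<open>x\<close> can be moved from the right factor onto \<open>T\<^sub>i\<close>, at the price of raising
  the index \<open>i\<close> by one.\<close>
lemma K_row:
  assumes x: "x \<in> carrier_vec n" and i: "Suc i < n"
    and G: "\<And>j. j \<le> Suc i \<Longrightarrow> (G *\<^sub>v x) $ j = L (cheb j * r)"
  shows "(K *\<^sub>v x) $ i = L (cheb i * ([:0, 1:] * r))"
proof (cases i)
  case 0
  have "(K *\<^sub>v x) $ i = (G *\<^sub>v x) $ Suc 0"
    using x i 0 by (auto simp: K_def G_def scalar_prod_def)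
  then show ?thesis using G[of "Suc 0"] 0 by simp
next
  case (Suc m)
  have eq: "L (cheb (Suc m) * ([:0, 1:] * p)) = (L (cheb (Suc (Suc m)) * p) + L (cheb m * p)) / 2" for p
  proof -
    have "L (p * cheb (Suc (Suc m))) = 2 * L (p * ([:0, 1:] * cheb (Suc m))) - L (p * cheb m)"
      by (rule cheb_rec_L)
    moreover have "p * ([:0, 1:] * cheb (Suc m)) = cheb (Suc m) * ([:0, 1:] * p)"
      by (simp only: mult_ac)
    ultimately have "L (cheb (Suc (Suc m)) * p)
        = 2 * L (cheb (Suc m) * ([:0, 1:] * p)) - L (cheb m * p)"
      by (simp only: mult.commute[of p])
    moreover have "s = (a + b) / 2" if "a = 2 * s - b" for a b s :: real
      using that by simp
    ultimately show ?thesis by blast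
  qed
  have Kx: "(K *\<^sub>v x) $ i = (\<Sum>j<n. L (cheb (Suc m) * ([:0, 1:] * cheb j)) * x $ j)"
    using x i Suc unfolding K_def by (simp add: scalar_prod_def lessThan_atLeast0)
  have Gx: "(G *\<^sub>v x) $ k = (\<Sum>j<n. L (cheb k * cheb j) * x $ j)" if "k < n" for k
    using x that unfolding G_def by (simp add: scalar_prod_def lessThan_atLeast0)
  have "(K *\<^sub>v x) $ i = ((G *\<^sub>v x) $ Suc (Suc m) + (G *\<^sub>v x) $ m) / 2"
  proof -
    have "(K *\<^sub>v x) $ i
        = (\<Sum>j<n. (L (cheb (Suc (Suc m)) * cheb j) * x $ j + L (cheb m * cheb j) * x $ j) / 2)"
      unfolding Kx eq by (simp only: times_divide_eq_left distrib_right)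
    also have "\<dots> = ((\<Sum>j<n. L (cheb (Suc (Suc m)) * cheb j) * x $ j)
        + (\<Sum>j<n. L (cheb m * cheb j) * x $ j)) / 2"
      by (simp only: sum_divide_distrib[symmetric] sum.distrib)
    finally show ?thesis using i Suc by (simp only: Gx)
  qed
  then show ?thesis using G[of "Suc (Suc m)"] G[of m] Suc by (simp only: eq)
qed

text \<open>The exactness of Gauss quadrature, with its limit \<open>2 n - 1\<close> on the degree. Up to
  \<open>k = n\<close> the vector \<open>T\<^sub>k\<^sub>-\<^sub>1(H) e\<^sub>0\<close> is a unit vector and the claim can be read off \<open>K\<close>. Each further step of the
  Chebyshev recurrence moves one factor \<open>x\<close> to the left by \<open>K_row\<close> and so uses up one of the rows
  of \<open>G\<close>; the bound on \<open>i + k\<close> ensures that the row \<open>i + 1\<close> is still there. The entry \<open>i = 0\<close> is the one that matters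
  in the end.\<close>
theorem G_cheb_vec:
  assumes "i < n" "i + k < 2 * n"
  shows "(G *\<^sub>v cheb_vec k) $ i = L (cheb i * cheb k)"
  using assms
proof (induction k arbitrary: i rule: cheb.induct)
  case 1
  then show ?case using G_unit[of i 0] n_pos by (simp add: cheb_vec_0 del: index_mult_mat_vec)
next
  case 2
  then show ?case using n_pos using K_unit[of i 0] by (simp add: G_cheb_vec_1 del: index_mult_mat_vec)
next
  case (3 k)
  have K: "(K *\<^sub>v cheb_vec (Suc k)) $ i = L (cheb i * ([:0, 1:] * cheb (Suc k)))"
  proof (cases "Suc k < n")
    case True
    then show ?thesis using 3(3) by (simp only: cheb_vec_unit K_unit)
  next
    case False
    then have i: "Suc i < n" using 3(4) by linarith
    have "(G *\<^sub>v cheb_vec (Suc k)) $ j = L (cheb j * cheb (Suc k))" if "j \<le> Suc i" for j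
      by (rule 3(1)) (use that i 3(4) in linarith)+
    then show ?thesis by (rule K_row[OF cheb_vec_carrier i])
  qed
  have "(G *\<^sub>v cheb_vec (Suc (Suc k))) $ i = 2 * (K *\<^sub>v cheb_vec (Suc k)) $ i - (G *\<^sub>v cheb_vec k) $ i"
    unfolding G_cheb_vec_rec using 3(3) by (simp del: index_mult_mat_vec)
  then show ?case using 3(2)[of i] 3(3,4) by (simp only: K cheb_rec_L add_Suc_right Suc_lessD)
qed

end

section \<open>Expansions in an orthonormal sequence\<close>

definition sq_integrable :: "'a measure \<Rightarrow> ('a \<Rightarrow> real) \<Rightarrow> bool" where
  "sq_integrable N f \<longleftrightarrow> f \<in> borel_measurable N \<and> integrable N (\<lambda>x. (f x)\<^sup>2)"

lemma sq_integrable_mult: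
  assumes "sq_integrable N f" "sq_integrable N g"
  shows "integrable N (\<lambda>x. f x * g x)"
proof (rule Bochner_Integration.integrable_bound)
  show "integrable N (\<lambda>x. (f x)\<^sup>2 + (g x)\<^sup>2)"
    using assms by (auto simp: sq_integrable_def)
  show "(\<lambda>x. f x * g x) \<in> borel_measurable N"
    using assms by (auto simp: sq_integrable_def)
  have "norm (a * b) \<le> norm (a\<^sup>2 + b\<^sup>2)" for a b :: real
  proof -
    have "2 * (\<bar>a\<bar> * \<bar>b\<bar>) \<le> a\<^sup>2 + b\<^sup>2"
      using sum_squares_bound[of "\<bar>a\<bar>" "\<bar>b\<bar>"] by (simp add: mult.assoc)
    moreover have "0 \<le> \<bar>a\<bar> * \<bar>b\<bar>" by simp
    ultimately have "\<bar>a\<bar> * \<bar>b\<bar> \<le> a\<^sup>2 + b\<^sup>2" by linarith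
    then show ?thesis by (simp add: abs_mult)
  qed
  then show "AE x in N. norm (f x * g x) \<le> norm ((f x)\<^sup>2 + (g x)\<^sup>2)"
    by simp
qed

lemma sq_integrable_add:
  assumes "sq_integrable N f" "sq_integrable N g"
  shows "sq_integrable N (\<lambda>x. f x + g x)"
proof -
  have "integrable N (\<lambda>x. (f x)\<^sup>2 + (g x)\<^sup>2 + 2 * (f x * g x))"
    using assms sq_integrable_mult[OF assms] by (auto simp: sq_integrable_def)
  then show ?thesis
    using assms by (auto simp: sq_integrable_def power2_sum mult.assoc)
qed

lemma sq_integrable_cmult:
  assumes "sq_integrable N f"
  shows "sq_integrable N (\<lambda>x. c * f x)"
  using assms by (auto simp: sq_integrable_def power_mult_distrib)

lemma sq_integrable_sum:
  assumes "\<And>i. i \<in> I \<Longrightarrow> sq_integrable N (f i)"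
  shows "sq_integrable N (\<lambda>x. \<Sum>i\<in>I. f i x)"
  using assms
proof (induction I rule: infinite_finite_induct)
  case (insert i I)
  then show ?case by (auto intro: sq_integrable_add)
qed (auto simp: sq_integrable_def)

lemma sq_integrable_diff:
  assumes "sq_integrable N f" "sq_integrable N g"
  shows "sq_integrable N (\<lambda>x. f x - g x)"
  using sq_integrable_add[OF assms(1) sq_integrable_cmult[OF assms(2), of "-1"]] by simp

text \<open>The quadratic \<open>t \<mapsto> \<integral>(f - t g)\<^sup>2\<close> is nonnegative; take \<open>t\<close> at its minimum, or, if \<open>g\<close> has norm
  zero, so large that the linear term would dominate.\<close>
lemma integral_Cauchy_Schwarz:
  assumes f: "sq_integrable N f" and g: "sq_integrable N g"
  shows "(\<integral>x. f x * g x \<partial>N)\<^sup>2 \<le> (\<integral>x. (f x)\<^sup>2 \<partial>N) * (\<integral>x. (g x)\<^sup>2 \<partial>N)"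
proof -
  define F B G where "F = (\<integral>x. (f x)\<^sup>2 \<partial>N)" and "B = (\<integral>x. f x * g x \<partial>N)"
    and "G = (\<integral>x. (g x)\<^sup>2 \<partial>N)"
  have int: "integrable N (\<lambda>x. (f x)\<^sup>2)" "integrable N (\<lambda>x. f x * g x)"
    "integrable N (\<lambda>x. (g x)\<^sup>2)"
    using f g sq_integrable_mult[OF f g] by (auto simp: sq_integrable_def)
  have pos: "0 \<le> F - 2 * t * B + t\<^sup>2 * G" for t
  proof -
    have "0 \<le> (\<integral>x. (f x - t * g x)\<^sup>2 \<partial>N)" by simp
    also have "\<dots> = (\<integral>x. (f x)\<^sup>2 - 2 * t * (f x * g x) + t\<^sup>2 * (g x)\<^sup>2 \<partial>N)"
      by (rule Bochner_Integration.integral_cong) (auto simp: power2_eq_square algebra_simps)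
    also have "\<dots> = F - 2 * t * B + t\<^sup>2 * G"
      using int by (simp add: F_def B_def G_def)
    finally show ?thesis .
  qed
  have "G \<ge> 0" by (simp add: G_def)
  have "B\<^sup>2 \<le> F * G"
  proof (cases "G = 0")
    case True
    have "B = 0"
    proof (rule ccontr)
      assume "B \<noteq> 0"
      with pos[of "(F + 1) / (2 * B)"] True show False by (simp add: field_simps)
    qed
    with True show ?thesis by simp
  next
    case False
    with \<open>G \<ge> 0\<close> have "G > 0" by simp
    with pos[of "B / G"] show ?thesis by (simp add: field_simps power2_eq_square)
  qed
  then show ?thesis by (simp add: F_def B_def G_def)
qed

lemma integral_mult_tendsto_zero:
  assumes f: "sq_integrable N f" and g: "\<And>m. sq_integrable N (g m)"
    and lim: "(\<lambda>m. \<integral>x. (g m x)\<^sup>2 \<partial>N) \<longlonglongrightarrow> 0"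
  shows "(\<lambda>m. \<integral>x. f x * g m x \<partial>N) \<longlonglongrightarrow> 0"
proof -
  have "(\<lambda>m. (\<integral>x. f x * g m x \<partial>N)\<^sup>2) \<longlonglongrightarrow> 0"
  proof (rule tendsto_sandwich[OF _ _ tendsto_const])
    show "(\<lambda>m. (\<integral>x. (f x)\<^sup>2 \<partial>N) * (\<integral>x. (g m x)\<^sup>2 \<partial>N)) \<longlonglongrightarrow> 0"
      using tendsto_mult_left[OF lim, of "\<integral>x. (f x)\<^sup>2 \<partial>N"] by simp
  qed (use integral_Cauchy_Schwarz[OF f g] in auto)
  then show ?thesis by (simp add: power_tendsto_0_iff)
qed

text \<open>Functions are handled through their coefficients: \<open>has_coeffs w a\<close> below says that
  \<open>\<Sum>\<^sub>l a\<^sub>l e\<^sub>l\<close> converges to \<open>w\<close> in \<open>L\<^sup>2\<close>. Asking for convergence, and not only for the inner products with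
  the \<open>e\<^sub>l\<close>, makes Parseval's identity available for sequences that are merely orthonormal.\<close>

locale orthonormal_sequence =
  fixes N :: "'a measure" and e :: "nat \<Rightarrow> 'a \<Rightarrow> real"
  assumes sq_e: "sq_integrable N (e l)"
    and orth: "(\<integral>x. e i x * e j x \<partial>N) = (if i = j then 1 else 0)"
begin

definition has_coeffs :: "('a \<Rightarrow> real) \<Rightarrow> (nat \<Rightarrow> real) \<Rightarrow> bool" where
  "has_coeffs w a \<longleftrightarrow> sq_integrable N w \<and>
     (\<lambda>m. \<integral>x. (w x - (\<Sum>l<m. a l * e l x))\<^sup>2 \<partial>N) \<longlonglongrightarrow> 0"

lemma sq_integrable_lincomb: "sq_integrable N (\<lambda>x. \<Sum>l\<in>I. a l * e l x)"
  by (intro sq_integrable_sum sq_integrable_cmult sq_e)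

lemma integral_mult_lincomb:
  assumes "sq_integrable N w"
  shows "(\<integral>x. w x * (\<Sum>l\<in>I. a l * e l x) \<partial>N) = (\<Sum>l\<in>I. a l * (\<integral>x. w x * e l x \<partial>N))"
proof -
  have "(\<integral>x. w x * (\<Sum>l\<in>I. a l * e l x) \<partial>N) = (\<integral>x. (\<Sum>l\<in>I. a l * (w x * e l x)) \<partial>N)"
    by (simp add: sum_distrib_left mult_ac)
  also have "\<dots> = (\<Sum>l\<in>I. a l * (\<integral>x. w x * e l x \<partial>N))"
    using sq_integrable_mult[OF assms sq_e] by (simp add: Bochner_Integration.integral_sum)
  finally show ?thesis .
qed

lemma integral_lincomb_basis:
  assumes "finite I"
  shows "(\<integral>x. (\<Sum>l\<in>I. a l * e l x) * e k x \<partial>N) = (if k \<in> I then a k else 0)"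
proof -
  have "(\<integral>x. (\<Sum>l\<in>I. a l * e l x) * e k x \<partial>N) = (\<Sum>l\<in>I. a l * (\<integral>x. e k x * e l x \<partial>N))"
    using integral_mult_lincomb[OF sq_e, of k a I] by (simp add: mult.commute)
  also have "\<dots> = (\<Sum>l\<in>I. if k = l then a l else 0)"
    by (rule sum.cong) (auto simp: orth)
  finally show ?thesis using assms by simp
qed

lemma Parseval_finite:
  assumes "finite I"
  shows "(\<integral>x. (\<Sum>l\<in>I. a l * e l x)\<^sup>2 \<partial>N) = (\<Sum>l\<in>I. (a l)\<^sup>2)"
  using integral_mult_lincomb[OF sq_integrable_lincomb[of a I], of a I]
  by (simp add: power2_eq_square integral_lincomb_basis[OF assms])

text \<open>For \<open>m > k\<close> the pairing of \<open>e\<^sub>k\<close> with the remainder \<open>w - \<Sum>\<^sub>l\<^sub><\<^sub>m a\<^sub>l e\<^sub>l\<close> no longer depends on \<open>m\<close>, while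
  by Cauchy-Schwarz it tends to zero.\<close>
lemma has_coeffs_inner_basis:
  assumes w: "has_coeffs w a"
  shows "(\<integral>x. w x * e k x \<partial>N) = a k"
proof -
  let ?r = "\<lambda>m x. w x - (\<Sum>l<m. a l * e l x)"
  have sw: "sq_integrable N w" using w by (simp add: has_coeffs_def)
  have sr: "sq_integrable N (?r m)" for m
    by (rule sq_integrable_diff[OF sw sq_integrable_lincomb])
  have "(\<lambda>m. \<integral>x. e k x * ?r m x \<partial>N) \<longlonglongrightarrow> 0"
    by (rule integral_mult_tendsto_zero[OF sq_e sr]) (use w in \<open>simp add: has_coeffs_def\<close>)
  moreover have "(\<integral>x. e k x * ?r m x \<partial>N) = (\<integral>x. w x * e k x \<partial>N) - a k" if "m > k" for m
  proof -
    have "(\<integral>x. e k x * ?r m x \<partial>N)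
        = (\<integral>x. w x * e k x - (\<Sum>l<m. a l * e l x) * e k x \<partial>N)"
      by (simp add: algebra_simps)
    also have "\<dots> = (\<integral>x. w x * e k x \<partial>N) - (\<integral>x. (\<Sum>l<m. a l * e l x) * e k x \<partial>N)"
      by (intro Bochner_Integration.integral_diff sq_integrable_mult sw sq_e sq_integrable_lincomb)
    finally show ?thesis using that by (simp add: integral_lincomb_basis)
  qed
  then have "\<forall>\<^sub>F m in sequentially. (\<integral>x. e k x * ?r m x \<partial>N) = (\<integral>x. w x * e k x \<partial>N) - a k"
    using eventually_gt_at_top by (rule eventually_mono[rotated])
  ultimately have "(\<lambda>m::nat. (\<integral>x. w x * e k x \<partial>N) - a k) \<longlonglongrightarrow> 0"
    by (simp add: filterlim_cong)
  then show ?thesis by (simp add: LIMSEQ_const_iff)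
qed

text \<open>Parseval's identity: pairing \<open>w\<close> with the partial sums of \<open>w'\<close> gives the partial sums of the
  series, and the remainder of \<open>w'\<close> contributes nothing in the limit.\<close>
lemma has_coeffs_inner:
  assumes w: "has_coeffs w a" and w': "has_coeffs w' b"
  shows "(\<lambda>l. a l * b l) sums (\<integral>x. w x * w' x \<partial>N)"
proof -
  let ?s = "\<lambda>m x. \<Sum>l<m. b l * e l x"
  have sw: "sq_integrable N w" "sq_integrable N w'" using w w' by (auto simp: has_coeffs_def)
  have "(\<lambda>m. \<integral>x. w x * (w' x - ?s m x) \<partial>N) \<longlonglongrightarrow> 0"
    by (rule integral_mult_tendsto_zero)
      (use sw w' in \<open>auto simp: has_coeffs_def intro!: sq_integrable_diff sq_integrable_lincomb\<close>)
  moreover have "(\<integral>x. w x * (w' x - ?s m x) \<partial>N) = (\<integral>x. w x * w' x \<partial>N) - (\<Sum>l<m. a l * b l)" for m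
  proof -
    have "(\<integral>x. w x * (w' x - ?s m x) \<partial>N) = (\<integral>x. w x * w' x - w x * ?s m x \<partial>N)"
      by (simp add: algebra_simps)
    also have "\<dots> = (\<integral>x. w x * w' x \<partial>N) - (\<integral>x. w x * ?s m x \<partial>N)"
      by (intro Bochner_Integration.integral_diff sq_integrable_mult sw sq_integrable_lincomb)
    finally show ?thesis
      by (simp add: integral_mult_lincomb[OF sw(1)] has_coeffs_inner_basis[OF w] mult.commute)
  qed
  ultimately have "(\<lambda>m. (\<integral>x. w x * w' x \<partial>N) - (\<Sum>l<m. a l * b l)) \<longlonglongrightarrow> 0" by simp
  from tendsto_diff[OF tendsto_const[of "\<integral>x. w x * w' x \<partial>N"] this]
  show ?thesis by (simp add: sums_def)
qed

lemma has_coeffs_basis: "has_coeffs (e k) (\<lambda>l. if l = k then 1 else 0)"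
proof -
  have "(\<Sum>l<m. (if l = k then 1 else 0) * e l x) = (if k < m then e k x else 0)" for m x
    by (simp add: if_distrib[of "\<lambda>c. c * _"] cong: if_cong)
  then have "\<forall>\<^sub>F m in sequentially.
      (\<integral>x. (e k x - (\<Sum>l<m. (if l = k then 1 else 0) * e l x))\<^sup>2 \<partial>N) = 0"
    by (intro eventually_mono[OF eventually_gt_at_top[of k]]) simp
  then show ?thesis by (simp add: has_coeffs_def sq_e tendsto_eventually)
qed

lemma has_coeffs_cmult:
  assumes "has_coeffs w a"
  shows "has_coeffs (\<lambda>x. c * w x) (\<lambda>l. c * a l)"
proof -
  have "(c * w x - (\<Sum>l<m. c * a l * e l x))\<^sup>2 = c\<^sup>2 * (w x - (\<Sum>l<m. a l * e l x))\<^sup>2" for m x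
    by (simp add: mult.assoc sum_distrib_left[symmetric] right_diff_distrib[symmetric] power_mult_distrib)
  moreover have "(\<lambda>m. c\<^sup>2 * (\<integral>x. (w x - (\<Sum>l<m. a l * e l x))\<^sup>2 \<partial>N)) \<longlonglongrightarrow> 0"
    using assms unfolding has_coeffs_def by (intro tendsto_mult_right_zero) auto
  ultimately show ?thesis using assms by (simp add: has_coeffs_def sq_integrable_cmult)
qed

text \<open>The usual completeness argument. Along a subsequence \<open>r\<close> the increments \<open>g\<^sub>j\<close> of the partial sums
  satisfy \<open>\<integral> g\<^sub>j\<^sup>2 \<le> 4\<^sup>-\<^sup>j\<close>, so that \<open>\<Sum>\<^sub>j 2\<^sup>j g\<^sub>j\<^sup>2\<close> is integrable and hence finite almost everywhere. As
  \<open>\<bar>g\<^sub>j\<bar> \<le> 2\<^sup>-\<^sup>j + 2\<^sup>j g\<^sub>j\<^sup>2\<close>, the subsequence converges almost everywhere, and Fatou's lemma bounds the \<open>L\<^sup>2\<close> distance of the limit to each partial sum by the tail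
  of \<open>\<Sum> a\<^sub>l\<^sup>2\<close>.\<close>
theorem Riesz_Fischer:
  assumes a: "summable (\<lambda>l. (a l)\<^sup>2)"
  shows "\<exists>w. has_coeffs w a"
proof -
  define S where "S m x = (\<Sum>l<m. a l * e l x)" for m x
  have sqS: "sq_integrable N (S m)" for m
    unfolding S_def by (rule sq_integrable_lincomb)
  have [measurable]: "S m \<in> borel_measurable N" for m
    using sqS by (simp add: sq_integrable_def)
  have normS: "(\<integral>\<^sup>+x. ennreal ((S m x - S k x)\<^sup>2) \<partial>N) = ennreal (\<Sum>l=k..<m. (a l)\<^sup>2)" if "k \<le> m" for k m
  proof -
    have "S m x - S k x = (\<Sum>l=k..<m. a l * e l x)" for x
      using that sum_diff_nat_ivl[of 0 k m "\<lambda>l. a l * e l x"] by (simp add: S_def lessThan_atLeast0)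
    then have "(\<integral>\<^sup>+x. ennreal ((S m x - S k x)\<^sup>2) \<partial>N) = ennreal (\<integral>x. (\<Sum>l=k..<m. a l * e l x)\<^sup>2 \<partial>N)"
      using sq_integrable_lincomb[of a "{k..<m}"] 
      by (subst nn_integral_eq_integral) (auto simp: sq_integrable_def)
    then show ?thesis by (simp add: Parseval_finite)
  qed
  define T where "T k = (\<Sum>l. (a (l + k))\<^sup>2)" for k
  have tail: "(\<Sum>l=k..<m. (a l)\<^sup>2) \<le> T k" for k m
  proof -
    have "(\<Sum>l=k..<m. (a l)\<^sup>2) = (\<Sum>l<m - k. (a (l + k))\<^sup>2)"
      by (cases "k \<le> m") (auto intro!: sum.reindex_bij_witness[of _ "\<lambda>i. i + k" "\<lambda>i. i - k"])
    also have "\<dots> \<le> T k"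
      unfolding T_def by (rule sum_le_suminf) (use a in \<open>auto simp: summable_iff_shift[of "\<lambda>l. (a l)\<^sup>2"]\<close>)
    finally show ?thesis .
  qed
  have T0: "T \<longlonglongrightarrow> 0"
    unfolding T_def using suminf_exist_split2[OF a] by simp
  have "\<exists>k. T k \<le> (1/4)^j" for j :: nat
  proof -
    have "\<forall>\<^sub>F k in sequentially. T k < (1/4)^j"
      by (rule order_tendstoD(2)[OF T0]) simp
    then show ?thesis by (metis eventually_sequentially less_imp_le order_refl)
  qed
  then obtain r0 where r0: "T (r0 j) \<le> (1/4)^j" for j by metis
  \<comment> \<open>The indices \<open>r0 j\<close> need not increase with \<open>j\<close>; raising them keeps the tail bound.\<close>
  define r where "r = rec_nat (r0 0) (\<lambda>j k. max (Suc k) (r0 (Suc j)))"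
  have r_Suc: "r (Suc j) = max (Suc (r j)) (r0 (Suc j))" for j by (simp add: r_def)
  have rr: "r0 j \<le> r j" for j by (cases j) (auto simp: r_def)
  have Tmono: "T m \<le> T k" if "k \<le> m" for k m
  proof -
    have *: "suminf (\<lambda>l. (a l)\<^sup>2) = T k + (\<Sum>l<k. (a l)\<^sup>2)" for k
      unfolding T_def by (rule suminf_split_initial_segment[OF a])
    have "(\<Sum>l<k. (a l)\<^sup>2) \<le> (\<Sum>l<m. (a l)\<^sup>2)" using that by (intro sum_mono2) auto
    with *[of k] *[of m] show ?thesis by linarith
  qed
  have Tr: "T (r j) \<le> (1/4)^j" for j using Tmono[OF rr] r0 order_trans by blast
  have r_mono: "strict_mono r" by (rule strict_monoI_Suc) (simp add: r_Suc)
  define g where "g j x = S (r (Suc j)) x - S (r j) x" for j x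
  have [measurable]: "g j \<in> borel_measurable N" for j unfolding g_def by measurable
  have "(\<integral>\<^sup>+x. (\<Sum>j. ennreal (2^j * (g j x)\<^sup>2)) \<partial>N) = (\<Sum>j. \<integral>\<^sup>+x. ennreal (2^j * (g j x)\<^sup>2) \<partial>N)"
    by (rule nn_integral_suminf) measurable
  also have "\<dots> \<le> (\<Sum>j. ennreal ((1/2)^j))"
  proof (rule suminf_le)
    fix j
    have "(\<integral>\<^sup>+x. ennreal (2^j * (g j x)\<^sup>2) \<partial>N) = ennreal (2^j) * (\<integral>\<^sup>+x. ennreal ((g j x)\<^sup>2) \<partial>N)"
      by (subst nn_integral_cmult[symmetric]) (auto simp: ennreal_mult')
    also have "\<dots> = ennreal (2^j * (\<Sum>l=r j..<r (Suc j). (a l)\<^sup>2))"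
    proof -
      have "r j \<le> r (Suc j)" by (simp add: r_Suc)
      then show ?thesis
        by (simp only: g_def normS) (simp add: ennreal_mult'[symmetric])
    qed
    also have "\<dots> \<le> ennreal (2^j * (1/4)^j)"
      using order_trans[OF tail[of "r j" "r (Suc j)"] Tr[of j]]
      by (intro ennreal_leI mult_left_mono) auto
    also have "(2::real)^j * (1/4)^j = (1/2)^j"
      by (simp flip: power_mult_distrib)
    finally show "(\<integral>\<^sup>+x. ennreal (2^j * (g j x)\<^sup>2) \<partial>N) \<le> ennreal ((1/2)^j)" .
  qed auto
  also have "\<dots> < \<infinity>"
    by (subst suminf_ennreal2) (auto intro!: summable_geometric)
  finally have "AE x in N. (\<Sum>j. ennreal (2^j * (g j x)\<^sup>2)) \<noteq> \<infinity>"
    by (intro nn_integral_noteq_infinite) auto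
  then have conv: "AE x in N. convergent (\<lambda>j. S (r j) x)"
  proof eventually_elim
    case (elim x)
    then have s1: "summable (\<lambda>j. 2^j * (g j x)\<^sup>2)"
      by (intro summable_suminf_not_top) auto
    have s2: "summable (\<lambda>j. (1/2::real)^j + 2^j * (g j x)\<^sup>2)"
      by (intro summable_add summable_geometric s1) auto
    \<comment> \<open>Expanding \<open>(1 - 2\<^sup>j \<bar>g\<^sub>j\<bar>)\<^sup>2 \<ge> 0\<close> gives this bound.\<close>
    have bound: "norm (g j x) \<le> (1/2)^j + 2^j * (g j x)\<^sup>2" for j
    proof -
      define p where "p = (2::real)^j"
      have p: "p > 0" "(1/2)^j = 1 / p" by (simp_all add: p_def power_one_over)
      have "0 \<le> (1 - p * \<bar>g j x\<bar>)\<^sup>2" by simp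
      then have "2 * p * \<bar>g j x\<bar> \<le> 1 + p\<^sup>2 * (g j x)\<^sup>2" by (simp add: power2_eq_square algebra_simps)
      moreover have "p * \<bar>g j x\<bar> \<ge> 0" using p by simp
      ultimately have "p * \<bar>g j x\<bar> \<le> 1 + p\<^sup>2 * (g j x)\<^sup>2" by linarith
      then have "\<bar>g j x\<bar> \<le> 1 / p + p * (g j x)\<^sup>2" using p by (simp add: field_simps power2_eq_square)
      then show ?thesis by (simp add: p flip: p_def)
    qed
    have "summable (\<lambda>j. g j x)"
      by (rule summable_comparison_test'[OF s2]) (use bound in auto)
    then have "convergent (\<lambda>j. S (r 0) x + (\<Sum>i<j. g i x))"
      by (intro convergent_add convergent_const) (simp add: summable_iff_convergent)
    moreover have "S (r 0) x + (\<Sum>i<j. g i x) = S (r j) x" for j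
      by (induction j) (auto simp: g_def)
    ultimately show ?case by simp
  qed
  define w where "w x = lim (\<lambda>j. S (r j) x)" for x
  have [measurable]: "w \<in> borel_measurable N"
    unfolding w_def by (rule borel_measurable_lim_metric) measurable
  have bound: "(\<integral>\<^sup>+x. ennreal ((w x - S m x)\<^sup>2) \<partial>N) \<le> ennreal (T m)" for m
  proof -
    have "(\<integral>\<^sup>+x. ennreal ((w x - S m x)\<^sup>2) \<partial>N)
        = (\<integral>\<^sup>+x. liminf (\<lambda>j. ennreal ((S (r j) x - S m x)\<^sup>2)) \<partial>N)"
    proof (rule nn_integral_cong_AE)
      show "AE x in N. ennreal ((w x - S m x)\<^sup>2) = liminf (\<lambda>j. ennreal ((S (r j) x - S m x)\<^sup>2))"
        using conv
      proof eventually_elim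
        case (elim x)
        then have "(\<lambda>j. S (r j) x) \<longlonglongrightarrow> w x" by (simp add: w_def convergent_LIMSEQ_iff)
        then have "(\<lambda>j. ennreal ((S (r j) x - S m x)\<^sup>2)) \<longlonglongrightarrow> ennreal ((w x - S m x)\<^sup>2)"
          by (intro tendsto_ennrealI tendsto_intros)
        then show ?case by (metis lim_imp_Liminf sequentially_bot)
      qed
    qed
    also have "\<dots> \<le> liminf (\<lambda>j. \<integral>\<^sup>+x. ennreal ((S (r j) x - S m x)\<^sup>2) \<partial>N)"
      by (rule nn_integral_liminf) measurable
    also have "\<dots> \<le> ennreal (T m)"
    proof (rule Liminf_le)
      show "\<forall>\<^sub>F j in sequentially. (\<integral>\<^sup>+x. ennreal ((S (r j) x - S m x)\<^sup>2) \<partial>N) \<le> ennreal (T m)"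
        using eventually_ge_at_top[of m]
      proof eventually_elim
        case (elim j)
        then have "m \<le> r j" using seq_suble[OF r_mono, of j] by simp
        then show ?case by (simp add: normS ennreal_leI[OF tail])
      qed
    qed simp
    finally show ?thesis .
  qed
  have Tnn: "T m \<ge> 0" for m using tail[of m m] by simp
  have sqd: "sq_integrable N (\<lambda>x. w x - S m x)" for m
    unfolding sq_integrable_def
  proof (intro conjI integrableI_bounded)
    have "(\<integral>\<^sup>+x. ennreal (norm ((w x - S m x)\<^sup>2)) \<partial>N) \<le> ennreal (T m)" using bound[of m] by simp
    also have "\<dots> < \<infinity>" by simp
    finally show "(\<integral>\<^sup>+x. ennreal (norm ((w x - S m x)\<^sup>2)) \<partial>N) < \<infinity>" .
  qed measurable
  have le: "(\<integral>x. (w x - S m x)\<^sup>2 \<partial>N) \<le> T m" for m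
  proof -
    have "ennreal (\<integral>x. (w x - S m x)\<^sup>2 \<partial>N) = (\<integral>\<^sup>+x. ennreal ((w x - S m x)\<^sup>2) \<partial>N)"
      using sqd[of m] by (intro nn_integral_eq_integral[symmetric]) (auto simp: sq_integrable_def)
    also have "\<dots> \<le> ennreal (T m)" by (rule bound)
    finally show ?thesis using Tnn by (simp add: ennreal_le_iff)
  qed
  have "(\<lambda>m. \<integral>x. (w x - S m x)\<^sup>2 \<partial>N) \<longlonglongrightarrow> 0"
    by (rule tendsto_sandwich[OF _ _ tendsto_const T0]) (use le in auto)
  moreover have "sq_integrable N w" using sqd[of 0] by (simp add: S_def)
  ultimately show ?thesis unfolding has_coeffs_def S_def by blast
qed

end

lemma summable_sq_mult_bounded:
  fixes a b :: "nat \<Rightarrow> real"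
  assumes a: "summable (\<lambda>l. (a l)\<^sup>2)" and b: "\<And>l. \<bar>b l\<bar> \<le> 1"
  shows "summable (\<lambda>l. (b l * a l)\<^sup>2)"
proof (rule summable_comparison_test'[OF a])
  fix l
  show "norm ((b l * a l)\<^sup>2) \<le> (a l)\<^sup>2"
    using b[of l] mult_left_le_one_le[of "\<bar>a l\<bar>" "\<bar>b l\<bar>"]
    by (simp add: abs_le_square_iff[symmetric] abs_mult)
qed

section \<open>The weighted space and the functional calculus\<close>

text \<open>Moving the weight into the measure turns \<open>wip\<close> into a plain integral of a product, so that the
  results on orthonormal sequences apply. Restricting the space, instead of multiplying by an
  indicator, matches the measurability condition of \<open>wL2\<close>, which says nothing about the values
  outside the interval.\<close>
definition weighted_measure :: "real \<Rightarrow> (real \<Rightarrow> real) \<Rightarrow> real measure" where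
  "weighted_measure X v
     = density (restrict_space lborel {0..X}) (\<lambda>x. ennreal (1 / (v x)\<^sup>2))"

locale weighted_interval =
  fixes X :: real and v :: "real \<Rightarrow> real"
  assumes v_cont: "continuous_on {0..X} v" and v_pos: "\<forall>x\<in>{0..X}. v x > 0"
begin

abbreviation W :: "real measure" where "W \<equiv> weighted_measure X v"

lemma borel_measurable_continuous_restrict:
  assumes "continuous_on {0..X} f"
  shows "f \<in> borel_measurable (restrict_space lborel {0..X})"
  using borel_measurable_continuous_on_restrict[OF assms]
  by (simp cong: measurable_cong_sets sets_restrict_space_cong)

lemma weight_measurable [measurable]:
  "(\<lambda>x. 1 / (v x)\<^sup>2) \<in> borel_measurable (restrict_space lborel {0..X})"
proof (rule borel_measurable_continuous_restrict)
  show "continuous_on {0..X} (\<lambda>x. 1 / (v x)\<^sup>2)"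
    using v_cont v_pos by (intro continuous_intros) force+
qed

lemma borel_measurable_W:
  "f \<in> borel_measurable W \<longleftrightarrow> f \<in> borel_measurable (restrict_space lborel {0..X})"
  by (simp add: weighted_measure_def)

lemma borel_measurable_W_iff:
  fixes f :: "real \<Rightarrow> real"
  shows "f \<in> borel_measurable W \<longleftrightarrow> set_borel_measurable lborel {0..X} f"
  by (simp add: borel_measurable_W borel_measurable_restrict_space_iff set_borel_measurable_def)

lemma integral_W:
  fixes f :: "real \<Rightarrow> real"
  assumes "f \<in> borel_measurable W"
  shows "(\<integral>x. f x \<partial>W) = (LINT x:{0..X}|lborel. f x * (1 / (v x)\<^sup>2))"
  using assms unfolding borel_measurable_W weighted_measure_def
  by (simp add: integral_density integral_restrict_space set_lebesgue_integral_def mult.commute)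

lemma integrable_W:
  fixes f :: "real \<Rightarrow> real"
  assumes "f \<in> borel_measurable W"
  shows "integrable W f \<longleftrightarrow> set_integrable lborel {0..X} (\<lambda>x. f x * (1 / (v x)\<^sup>2))"
  using assms unfolding borel_measurable_W weighted_measure_def
  by (simp add: integrable_density integrable_restrict_space set_integrable_def mult.commute)

lemma wL2_iff: "f \<in> wL2 X v \<longleftrightarrow> sq_integrable W f"
  using integrable_W[of "\<lambda>x. (f x)\<^sup>2"]
  by (auto simp: wL2_def sq_integrable_def borel_measurable_W_iff[symmetric])

lemma wip_eq:
  assumes "f \<in> borel_measurable W" "g \<in> borel_measurable W"
  shows "wip X v f g = (\<integral>x. f x * g x \<partial>W)"
  using assms by (simp add: wip_def integral_W)

end

text \<open>The eigenfunctions form an orthonormal sequence in the weighted space, and an operator \<open>g(A)\<close> multiplies the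
  coefficients by \<open>g(\<lambda>\<^sub>l)\<close>.\<close>

locale spectral_problem = weighted_interval +
  fixes lam :: "nat \<Rightarrow> real" and z :: "nat \<Rightarrow> real \<Rightarrow> real"
  assumes eigen: "eigensystem X v lam z"
begin

lemma z_measurable: "z l \<in> borel_measurable W"
proof -
  have "A_graph X v (z l) (\<lambda>x. lam l * z l x)"
    using eigen by (simp add: eigensystem_def eigenpair_def)
  then obtain u' where "\<forall>x\<in>{0..X}. (z l has_real_derivative u' x) (at x within {0..X})"
    by (auto simp: A_graph_def)
  then have "continuous_on {0..X} (z l)"
    by (intro DERIV_continuous_on) auto
  then show ?thesis
    by (simp add: borel_measurable_W borel_measurable_continuous_restrict)
qed

lemma z_orth: "(\<integral>x. z i x * z j x \<partial>W) = (if i = j then 1 else 0)"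
  using eigen by (simp add: eigensystem_def wip_eq[OF z_measurable z_measurable, symmetric])

sublocale orthonormal_sequence W z
proof
  fix l
  have "integrable W (\<lambda>x. z l x * z l x)"
    using z_orth[of l l] not_integrable_integral_eq by force
  then show "sq_integrable W (z l)"
    by (simp add: sq_integrable_def z_measurable power2_eq_square)
qed (rule z_orth)

lemma has_coeffs_sq_integrable: "has_coeffs w a \<Longrightarrow> sq_integrable W w"
  by (simp add: has_coeffs_def)

lemma wip_sq_integrable:
  "sq_integrable W f \<Longrightarrow> sq_integrable W g \<Longrightarrow> wip X v f g = (\<integral>x. f x * g x \<partial>W)"
  by (simp add: wip_eq sq_integrable_def)

lemma wip_has_coeffs:
  assumes "has_coeffs w a" "has_coeffs w' b"
  shows "(\<lambda>l. a l * b l) sums wip X v w w'"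
  using has_coeffs_inner[OF assms] assms by (simp add: wip_sq_integrable has_coeffs_sq_integrable)

lemma wip_eigenfunction:
  assumes "has_coeffs w a"
  shows "wip X v w (z l) = a l"
  using has_coeffs_inner_basis[OF assms] assms
  by (simp add: wip_sq_integrable has_coeffs_sq_integrable sq_e)

text \<open>\<open>fun_calc\<close> chooses some limit of the series; the Riesz-Fischer theorem says that there is one. Its
  coefficients do not depend on the choice.\<close>
lemma fun_calc_has_coeffs:
  assumes "summable (\<lambda>l. (g (lam l) * \<phi> (z l))\<^sup>2)"
  shows "has_coeffs (fun_calc X v lam z g \<phi>) (\<lambda>l. g (lam l) * \<phi> (z l))"
proof -
  let ?a = "\<lambda>l. g (lam l) * \<phi> (z l)"
  have "wip X v (\<lambda>x. w x - (\<Sum>l<m. ?a l * z l x)) (\<lambda>x. w x - (\<Sum>l<m. ?a l * z l x))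
      = (\<integral>x. (w x - (\<Sum>l<m. ?a l * z l x))\<^sup>2 \<partial>W)" if "sq_integrable W w" for w m
    using sq_integrable_diff[OF that sq_integrable_lincomb[of ?a "{..<m}"]]
    by (simp add: wip_sq_integrable power2_eq_square)
  then have iff: "w \<in> wL2 X v \<and>
      (\<lambda>m. let r = (\<lambda>x. w x - (\<Sum>l<m. ?a l * z l x)) in wip X v r r) \<longlonglongrightarrow> 0
      \<longleftrightarrow> has_coeffs w ?a" for w
    by (auto simp: wL2_iff has_coeffs_def)
  from Riesz_Fischer[OF assms] show ?thesis
    unfolding fun_calc_def iff by (rule someI_ex)
qed

lemma fun_op_has_coeffs:
  assumes w: "has_coeffs w a" and s: "summable (\<lambda>l. (g (lam l) * a l)\<^sup>2)"
  shows "has_coeffs (fun_op X v lam z g w) (\<lambda>l. g (lam l) * a l)"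
  using fun_calc_has_coeffs[of g "wip X v w"] s
  unfolding fun_op_def wip_eigenfunction[OF w] by blast

text \<open>Test positive definiteness on an eigenfunction.\<close>
lemma pos_def_imp_spectrum_pos:
  assumes "pos_def_op X v (fun_op X v lam z g)"
  shows "g (lam k) > 0"
proof -
  let ?d = "\<lambda>l. if l = k then 1 else 0 :: real"
  have "summable (\<lambda>l. (g (lam l) * ?d l)\<^sup>2)"
    by (rule summable_finite[of "{k}"]) auto
  then have "has_coeffs (fun_op X v lam z g (z k)) (\<lambda>l. g (lam l) * ?d l)"
    by (rule fun_op_has_coeffs[OF has_coeffs_basis])
  from wip_has_coeffs[OF has_coeffs_basis[of k] this]
  have "(\<lambda>l. if l = k then g (lam l) else 0) sums wip X v (z k) (fun_op X v lam z g (z k))"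
    by (simp add: if_distrib[of "\<lambda>c. c * _"] if_distrib[of "\<lambda>c. _ * c"] cong: if_cong)
  then have eq: "wip X v (z k) (fun_op X v lam z g (z k)) = g (lam k)"
    using sums_single[of k "\<lambda>l. g (lam l)"] sums_unique2 by blast
  have "z k \<in> wL2 X v" by (simp add: wL2_iff sq_e)
  moreover have "wip X v (z k) (z k) \<noteq> 0" using eigen by (simp add: eigensystem_def)
  ultimately show ?thesis using assms eq by (auto simp: pos_def_op_def)
qed

end

section \<open>The push-forward measure and its points of increase\<close>

lemma emeasure_eta0:
  assumes A: "A \<in> sets borel"
  shows "emeasure (eta0 v lam z q \<tau>) A
    = (\<Sum>l. ennreal (qt q (lam l) * ((z l 0)\<^sup>2 / (v 0)\<^sup>2)) * indicator A (cos (\<tau> * sqrt (lam l))))"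
proof -
  have m: "(\<lambda>s::real. cos (\<tau> * sqrt s)) \<in> borel_measurable borel"
    by (intro borel_measurable_continuous_onI continuous_intros)
  have "emeasure (eta0 v lam z q \<tau>) A
      = emeasure (density (count_space UNIV) (\<lambda>l. ennreal (qt q (lam l) * ((z l 0)\<^sup>2 / (v 0)\<^sup>2))))
          {l. cos (\<tau> * sqrt (lam l)) \<in> A}"
    using A m unfolding eta0_def spectral_measure_def
    by (subst emeasure_distr, simp, simp, subst emeasure_distr)
      (auto simp: vimage_def intro!: borel_measurable_count_space measurable_sets[OF m, unfolded vimage_def, simplified])
  also have "\<dots> = (\<Sum>l. ennreal (qt q (lam l) * ((z l 0)\<^sup>2 / (v 0)\<^sup>2)) *
      indicator {l. cos (\<tau> * sqrt (lam l)) \<in> A} l)"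
    by (simp add: emeasure_density nn_integral_count_space_nat)
  finally show ?thesis by (simp add: indicator_def)
qed

text \<open>If no atom lies within \<open>\<epsilon>\<close> of \<open>s\<close>, the intervals up to \<open>s - \<epsilon>\<close> and up to \<open>s + \<epsilon>\<close> contain the same atoms
  and therefore have the same measure.\<close>
lemma point_of_increase_near_atom:
  assumes inc: "point_of_increase
      (\<lambda>s. measure (scale_measure r (eta0 v lam z q \<tau>)) {-1..s}) s" and "\<epsilon> > 0"
  shows "\<exists>l. qt q (lam l) * ((z l 0)\<^sup>2 / (v 0)\<^sup>2) > 0 \<and> \<bar>cos (\<tau> * sqrt (lam l)) - s\<bar> \<le> \<epsilon>"
proof (rule ccontr)
  assume no: "\<not> ?thesis"
  let ?h = "\<lambda>l. qt q (lam l) * ((z l 0)\<^sup>2 / (v 0)\<^sup>2)" and ?\<mu> = "\<lambda>l. cos (\<tau> * sqrt (lam l))"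
  have "ennreal (?h l) * indicator {-1..s - \<epsilon>} (?\<mu> l)
      = ennreal (?h l) * indicator {-1..s + \<epsilon>} (?\<mu> l)" for l
  proof (cases "?h l > 0")
    case True
    with no have "\<bar>?\<mu> l - s\<bar> > \<epsilon>" by force
    then have "?\<mu> l \<in> {-1..s - \<epsilon>} \<longleftrightarrow> ?\<mu> l \<in> {-1..s + \<epsilon>}" using \<open>\<epsilon> > 0\<close> by auto
    then show ?thesis by (simp only: indicator_def)
  next
    case False
    then show ?thesis by (simp add: ennreal_neg)
  qed
  then have "emeasure (eta0 v lam z q \<tau>) {-1..s - \<epsilon>} = emeasure (eta0 v lam z q \<tau>) {-1..s + \<epsilon>}"
    by (simp only: emeasure_eta0 borel_closed closed_atLeastAtMost)
  then show False using inc \<open>\<epsilon> > 0\<close> by (auto simp: point_of_increase_def measure_def)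
qed

text \<open>A polynomial whose square has zero weighted sum vanishes at all atoms, hence, being continuous,
  on their closure. With \<open>n\<close> points in the closure, its degree is too small unless it is zero. Points of
  increase need not be atoms themselves, which is why the closure enters.\<close>
lemma weighted_square_sum_definite:
  fixes w \<mu> :: "nat \<Rightarrow> real"
  assumes w: "\<And>l. w l \<ge> 0" and summ: "summable (\<lambda>l. w l * poly (p * p) (\<mu> l))"
    and S: "finite S" "card S = n"
    and near: "\<And>s \<epsilon>. s \<in> S \<Longrightarrow> \<epsilon> > 0 \<Longrightarrow> \<exists>l. w l > 0 \<and> \<bar>\<mu> l - s\<bar> \<le> \<epsilon>"
    and p: "degree p < n" "(\<Sum>l. w l * poly (p * p) (\<mu> l)) = 0"
  shows "p = 0"
proof (rule ccontr)
  assume "p \<noteq> 0"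
  have "w l * poly (p * p) (\<mu> l) = 0" for l
    using suminf_eq_zero_iff[OF summ] w p(2) by simp
  then have atom: "poly p (\<mu> l) = 0" if "w l > 0" for l
    using that by (metis less_irrefl mult_eq_0_iff poly_mult)
  have "poly p s = 0" if s: "s \<in> S" for s
  proof (rule ccontr)
    assume "poly p s \<noteq> 0"
    then have "\<forall>\<^sub>F x in nhds s. poly p x \<noteq> 0"
      by (intro tendsto_imp_eventually_ne) (auto intro!: isCont_def[THEN iffD1]
          simp: tendsto_at_iff_tendsto_nhds[symmetric] poly_isCont[unfolded isCont_def])
    then obtain d where "d > 0" and d: "\<And>x. dist x s < d \<Longrightarrow> poly p x \<noteq> 0"
      by (auto simp: eventually_nhds_metric)
    then obtain l where "w l > 0" "\<bar>\<mu> l - s\<bar> \<le> d / 2" using near[OF s, of "d / 2"] by auto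
    then show False using atom[of l] d[of "\<mu> l"] \<open>d > 0\<close> by (simp add: dist_real_def)
  qed
  then have "card S \<le> card {x. poly p x = 0}"
    by (intro card_mono poly_roots_finite \<open>p \<noteq> 0\<close>) auto
  also have "\<dots> \<le> degree p" by (rule card_poly_roots_bound[OF \<open>p \<noteq> 0\<close>])
  finally show False using S p by simp
qed

lemma summable_weighted_poly:
  fixes w \<mu> :: "nat \<Rightarrow> real"
  assumes w: "summable w" "\<And>l. w l \<ge> 0" and \<mu>: "\<And>l. \<bar>\<mu> l\<bar> \<le> 1"
  shows "summable (\<lambda>l. w l * poly p (\<mu> l))"
proof -
  have "bounded (poly p ` {-1..1})"
    by (intro compact_imp_bounded compact_continuous_image continuous_intros) auto
  then obtain B where B: "\<And>x. x \<in> {-1..1} \<Longrightarrow> \<bar>poly p x\<bar> \<le> B"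
    by (auto simp: bounded_iff simp del: atLeastAtMost_iff)
  show ?thesis
  proof (rule summable_comparison_test')
    show "summable (\<lambda>l. B * w l)" by (intro summable_mult w)
    fix l
    have "\<bar>poly p (\<mu> l)\<bar> \<le> B" using \<mu>[of l] by (intro B) (auto simp: abs_le_iff)
    then have "w l * \<bar>poly p (\<mu> l)\<bar> \<le> w l * B" by (intro mult_left_mono w)
    then show "norm (w l * poly p (\<mu> l)) \<le> B * w l" using w(2)[of l] by (simp add: abs_mult mult.commute)
  qed
qed

section \<open>The reduced-order propagator\<close>

lemma row_comb_unit_vec: "k < n \<Longrightarrow> row_comb u (unit_vec n k) x = u k x"
  by (simp add: row_comb_def if_distrib[of "\<lambda>c. c * _"] cong: if_cong)

theorem lemma4p2:
  fixes X \<tau> c :: real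
    and v q :: "real \<Rightarrow> real"
    and lam :: "nat \<Rightarrow> real" and z u :: "nat \<Rightarrow> real \<Rightarrow> real"
    and P :: "(real \<Rightarrow> real) \<Rightarrow> real \<Rightarrow> real"
    and f :: "nat \<Rightarrow> real"
    and M :: "real measure"
    and n :: nat
    and G H :: "real mat"
  defines "u \<equiv> snapshot X v lam z q \<tau>"
    and "P \<equiv> propagator X v lam z \<tau>"
    and "f \<equiv> (\<lambda>k. wip X v (u 0) (u k))"
    and "c \<equiv> f 0"
    and "M \<equiv> scale_measure (ennreal (1 / c)) (eta0 v lam z q \<tau>)"
    and "G \<equiv> gram X v n u (\<lambda>w. w)"
    and "H \<equiv> the (mat_inverse G) * gram X v n u P"
  assumes "X > 0"
    and "continuous_on {0..X} v" and "\<forall>x\<in>{0..X}. v x > 0"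
    and "eigensystem X v lam z"
    and "integrable lborel q" and "\<forall>t. q (- t) = q t"
    and "\<forall>s. qt q (s\<^sup>2) \<ge> 0"
    and "pos_def_op X v (fun_op X v lam z (qt q))"
    and "\<tau> > 0" and "n \<ge> 1"
    and "prob_space M"
    and "at_least_points_of_increase n M"
  shows "invertible_mat G \<and>
    (\<forall>k<n. AE x\<in>{0..X} in lborel.
       u k x = row_comb u (poly_mat (cheb k) H *\<^sub>v unit_vec n 0) x) \<and>
    (\<forall>k<2 * n. f k = unit_vec n 0 \<bullet> ((G * poly_mat (cheb k) H) *\<^sub>v unit_vec n 0))"
proof -
  interpret spectral_problem X v lam z
    by unfold_locales (use assms in auto)
  have v0: "v 0 > 0" using assms by auto
  define \<mu> where "\<mu> l = cos (\<tau> * sqrt (lam l))" for l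
  define \<alpha> where "\<alpha> l = sqrt (qt q (lam l)) * (z l 0 / v 0)" for l
  define L where "L p = (\<Sum>l. (\<alpha> l)\<^sup>2 * poly p (\<mu> l))" for p
  have q_pos: "qt q (lam l) > 0" for l
    by (rule pos_def_imp_spectrum_pos) fact
  then have \<alpha>_sq: "(\<alpha> l)\<^sup>2 = qt q (lam l) * ((z l 0)\<^sup>2 / (v 0)\<^sup>2)" for l
    by (simp add: \<alpha>_def power_mult_distrib power_divide less_imp_le)
  have \<mu>_le: "\<bar>\<mu> l\<bar> \<le> 1" for l by (simp add: \<mu>_def abs_le_iff)
  \<comment> \<open>Total mass one excludes infinite mass: this is what makes the source an \<open>L\<^sup>2\<close> function.\<close>
  have summ: "summable (\<lambda>l. (\<alpha> l)\<^sup>2)"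
  proof (rule summable_suminf_not_top)
    have "space M = UNIV" by (simp add: M_def space_scale_measure eta0_def)
    with \<open>prob_space M\<close> have "emeasure M UNIV = 1"
      using prob_space.emeasure_space_1 by force
    then have "ennreal (1 / c) * (\<Sum>l. ennreal ((\<alpha> l)\<^sup>2)) = 1"
      by (simp add: M_def emeasure_eta0 \<alpha>_sq)
    then show "(\<Sum>l. ennreal ((\<alpha> l)\<^sup>2)) \<noteq> top_class.top"
      by (auto simp: ennreal_mult_top split: if_splits)
  qed simp
  have source: "has_coeffs (source X v lam z q) \<alpha>"
  proof -
    let ?b = "\<lambda>l. sqrt (qt q (lam l)) * delta0 v (z l)"
    have b: "?b l = 1 / v 0 * \<alpha> l" for l
      by (simp add: delta0_def \<alpha>_def power2_eq_square)
    have "summable (\<lambda>l. (1 / v 0)\<^sup>2 * (\<alpha> l)\<^sup>2)" by (intro summable_mult summ)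
    then have "summable (\<lambda>l. (?b l)\<^sup>2)" unfolding b power_mult_distrib .
    then have "has_coeffs (fun_calc X v lam z (\<lambda>s. sqrt (qt q s)) (delta0 v)) ?b"
      by (rule fun_calc_has_coeffs)
    from has_coeffs_cmult[OF this, of "v 0"] v0 show ?thesis
      unfolding b source_def by simp
  qed
  have u: "has_coeffs (u k) (\<lambda>l. poly (cheb k) (\<mu> l) * \<alpha> l)"
    and u_summ: "summable (\<lambda>l. (poly (cheb k) (\<mu> l) * \<alpha> l)\<^sup>2)" for k
  proof -
    have eq: "cos (real k * \<tau> * sqrt (lam l)) = poly (cheb k) (\<mu> l)" for l
      by (simp add: \<mu>_def poly_cheb_cos mult.assoc)
    show *: "summable (\<lambda>l. (poly (cheb k) (\<mu> l) * \<alpha> l)\<^sup>2)"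
      by (intro summable_sq_mult_bounded summ) (simp add: eq[symmetric] abs_le_iff)
    then show "has_coeffs (u k) (\<lambda>l. poly (cheb k) (\<mu> l) * \<alpha> l)"
      using fun_op_has_coeffs[OF source, of "\<lambda>s. cos (real k * \<tau> * sqrt s)"]
      by (simp add: u_def snapshot_def eq)
  qed
  have Pu: "has_coeffs (P (u k)) (\<lambda>l. \<mu> l * (poly (cheb k) (\<mu> l) * \<alpha> l))" for k
    using fun_op_has_coeffs[OF u, of "\<lambda>s. cos (\<tau> * sqrt s)" k]
      summable_sq_mult_bounded[OF u_summ[of k] \<mu>_le]
    by (simp add: P_def propagator_def \<mu>_def)
  have uu: "wip X v (u i) (u j) = L (cheb i * cheb j)" for i j
    using sums_unique[OF wip_has_coeffs[OF u[of i] u[of j]]]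
    by (simp add: L_def power2_eq_square mult_ac)
  have uPu: "wip X v (u i) (P (u j)) = L (cheb i * ([:0, 1:] * cheb j))" for i j
    using sums_unique[OF wip_has_coeffs[OF u[of i] Pu[of j]]]
    by (simp add: L_def power2_eq_square mult_ac)
  have L_summ: "summable (\<lambda>l. (\<alpha> l)\<^sup>2 * poly p (\<mu> l))" for p
    by (intro summable_weighted_poly summ \<mu>_le) simp
  interpret D: definite_functional L n
  proof
    show "L (p + r) = L p + L r" for p r
      unfolding L_def by (subst suminf_add) (auto simp: L_summ distrib_left)
    show "L (Polynomial.smult a p) = a * L p" for a p
      unfolding L_def by (subst suminf_mult[OF L_summ, symmetric]) (simp add: mult_ac)
    show "n \<ge> 1" by fact
    fix p assume p: "degree p < n" "L (p * p) = 0"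
    obtain S where S: "finite S" "card S = n"
      "\<And>s. s \<in> S \<Longrightarrow> point_of_increase (\<lambda>s. measure M {-1..s}) s"
      using \<open>at_least_points_of_increase n M\<close> by (auto simp: at_least_points_of_increase_def)
    show "p = 0"
    proof (rule weighted_square_sum_definite[OF _ L_summ S(1,2) _ p(1)])
      fix s \<epsilon> :: real assume "s \<in> S" "\<epsilon> > 0"
      then show "\<exists>l. (\<alpha> l)\<^sup>2 > 0 \<and> \<bar>\<mu> l - s\<bar> \<le> \<epsilon>"
        using point_of_increase_near_atom[OF S(3)[unfolded M_def]] by (simp only: \<alpha>_sq \<mu>_def)
    qed (use p(2) in \<open>auto simp: L_def\<close>)
  qed
  have G: "G = D.G" by (simp add: G_def gram_def D.G_def uu)
  have "gram X v n u P = D.K" by (simp add: gram_def D.K_def uPu)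
  then have H: "H = D.H" by (simp add: H_def D.H_def G)
  show ?thesis
  proof (intro conjI allI impI)
    show "invertible_mat G" unfolding G by (rule D.invertible_G)
  next
    fix k assume "k < n"
    then show "AE x\<in>{0..X} in lborel. u k x = row_comb u (poly_mat (cheb k) H *\<^sub>v unit_vec n 0) x"
      by (simp add: H D.cheb_vec_unit[unfolded D.cheb_vec_def] row_comb_unit_vec)
  next
    fix k assume k: "k < 2 * n"
    have "unit_vec n 0 \<bullet> ((G * poly_mat (cheb k) H) *\<^sub>v unit_vec n 0)
        = unit_vec n 0 \<bullet> (D.G *\<^sub>v D.cheb_vec k)"
      unfolding G H D.cheb_vec_def
      by (simp only: assoc_mult_mat_vec[OF D.G_carrier poly_mat_carrier[OF D.H_carrier] unit_vec_carrier])
    also have "\<dots> = (D.G *\<^sub>v D.cheb_vec k) $ 0"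
      using \<open>n \<ge> 1\<close> by (intro scalar_prod_left_unit) (auto intro!: mult_mat_vec_carrier[of _ n n])
    also have "\<dots> = L (cheb 0 * cheb k)"
      using D.G_cheb_vec[of 0 k] k by simp
    finally show "f k = unit_vec n 0 \<bullet> ((G * poly_mat (cheb k) H) *\<^sub>v unit_vec n 0)"
      by (simp only: f_def uu)
  qed
qed

end
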